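(* Let $n\ge2$ be an integer, $1<p<\min\{2,\sqrt n\}$, and assume that the data $(F_p,\phi_p,\beta_p)$ are admissible at $p$ (see context). Then there exists $g_0\in Q$ such that $Tg_0=g_0$. Equivalently, for all $r\ge0$, $$g_0(r)=\int_r^\infty\left[s^{1-n}\int_0^s t^{n-1}F_p(t,g_0(t),|g_0'(t)|)\,g_0(t)^{-\beta_p}\,dt\right]^{\frac1{p-1}}ds.$$
   Context: **Data and admissibility.** Let $0<\alpha\le1$ and let $\ell,\xi_1,\xi_2>0$ be constants. Put $\varphi_p(r):=\max\{\ell,r\}^{-\frac{n-p}{p-1}}$, $r\ge0$. Let $\beta_p\in\mathbb R$ and functions $F_p:[0,\infty)^3\to\mathbb R$, $\phi_p:[0,\infty)^2\to\mathbb R$ be given (the function $\phi_p$ is not to be confused with $\varphi_p$). The data $(F_p,\phi_p,\beta_p)$ are *admissible at $p$* if all of the following hold: (0) $0\le\beta_p<p-1$ and $\ell^{-(n-p)/(p-1)}\le\xi_1^2$. (1) $F_p\in C^{0,\alpha}_{\mathrm{loc}}([0,\infty)^3)$, $\phi_p\in C^0([0,\infty)^2)$, and $0\le\phi_p(r,u)\le F_p(r,u,\rho)$ for all $r\ge0$, $0<u\le\xi_1$, $0\le\rho\le\xi_2$. (2) For every $r\ge0$, $u\mapsto\phi_p(r,u)$ is nondecreasing on $[0,\xi_1]$, and $(u,\rho)\mapsto F_p(r,u,\rho)$ is nondecreasing in each variable on $[0,\xi_1]\times[0,\xi_2]$. (3) $\xi_1^{p-1-\beta_p}\left(\frac{p-1}{n-p}\right)^{p-1}\int_0^\ell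 t^{n-1}\phi_p(t,\xi_1^{-1}\varphi_p(t))\,dt\ge1$. (4) $\int_0^\infty\left[s^{1-n}\int_0^s t^{n-1}F_p(t,\xi_1,\xi_2)\varphi_p(t)^{-\beta_p}\,dt\right]^{1/(p-1)}ds\le\xi_1^{1-\beta_p/(p-1)}$. (5) For every $s>0$, $s^{1-n}\int_0^s t^{n-1}F_p(t,\xi_1,\xi_2)\varphi_p(t)^{-\beta_p}\,dt\le\xi_2^{p-1}\xi_1^{-\beta_p}$. (6) There is a constant $C>0$, independent of $r$, with $F_p(r,\xi_1,\xi_2)\varphi_p(r)^{-\beta_p}<C$ for all $r\ge0$. (7) $\int_0^\infty t^{n-1}F_p(t,\xi_1,\xi_2)\varphi_p(t)^{-\beta_p}\,dt<\infty$. **The set $Q$ and the operator $T$.** $\Lambda$ is the set of measurable $h:[0,\infty)\to[0,\infty)$ with $\int_0^\infty\left[s^{1-n}\int_0^s t^{n-1}h(t)\,dt\right]^{1/(p-1)}ds<\infty$. For $h\in\Lambda$ put $\mathtt L_h(r):=\int_r^\infty\left[s^{1-n}\int_0^s t^{n-1}h(t)\,dt\right]^{1/(p-1)}ds$. Let $$Q:=\{g\in\Lambda\cap C^1([0,\infty))\mid \xi_1^{-1}\varphi_p(r)\le g(r)\le\xi_1,\ |g'(r)|\le\xi_2\ \text{for all } r\ge0\}.$$ For $g\in Q$ put $\mathcal Kg(r):=F_p(r,g(r),|g'(r)|)\,g(r)^{-\beta_p}$ (which belongs to $\Lambda$) and $Tg:=\mathtt L_{\mathcal Kg}$. *)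

theory Defs
  imports "HOL-Analysis.Analysis"
begin

text \<open>
  Functions on \<open>[0,\<infinity>)\<close> are represented by total functions \<open>real \<Rightarrow> real\<close>; every condition below
  only concerns their values on \<open>{0..}\<close>, and all integrals are Lebesgue integrals.
\<close>

definition locally_holder_on :: "real \<Rightarrow> 'a::metric_space set \<Rightarrow> ('a \<Rightarrow> 'b::metric_space) \<Rightarrow> bool" where
  "locally_holder_on \<alpha> S f \<longleftrightarrow>
     (\<forall>K. compact K \<and> K \<subseteq> S \<longrightarrow>
        (\<exists>C\<ge>0. \<forall>x\<in>K. \<forall>y\<in>K. dist (f x) (f y) \<le> C * dist x y powr \<alpha>))"

text \<open>The derivative on the half-line, one-sided at \<open>0\<close>.\<close>

definition dhalf :: "(real \<Rightarrow> real) \<Rightarrow> real \<Rightarrow> real" where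
  "dhalf g r = vector_derivative g (at r within {0..})"

definition C1_halfline :: "(real \<Rightarrow> real) \<Rightarrow> bool" where
  "C1_halfline g \<longleftrightarrow> g differentiable_on {0..} \<and> continuous_on {0..} (dhalf g)"

definition profile :: "nat \<Rightarrow> real \<Rightarrow> real \<Rightarrow> real \<Rightarrow> real" where
  "profile n p l r = max l r powr (- ((real n - p) / (p - 1)))"

definition flux :: "nat \<Rightarrow> (real \<Rightarrow> real) \<Rightarrow> real \<Rightarrow> real" where
  "flux n h s = s powr (1 - real n) * (LINT t:{0..s}|lebesgue. t ^ (n - 1) * h t)"

text \<open>
  For \<open>h \<ge> 0\<close>, finiteness of the outer integral forces the inner integrals to be finite: if one
  of them is infinite, so are all those with a larger upper limit. As the Bochner integral of a
  non-integrable function is \<open>0\<close>, both requirements are stated through integrability.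
\<close>

definition Lambda :: "nat \<Rightarrow> real \<Rightarrow> (real \<Rightarrow> real) set" where
  "Lambda n p = {h. h \<in> borel_measurable (lebesgue_on {0..}) \<and> (\<forall>r\<ge>0. 0 \<le> h r) \<and>
     (\<forall>s>0. set_integrable lebesgue {0..s} (\<lambda>t. t ^ (n - 1) * h t)) \<and>
     set_integrable lebesgue {0..} (\<lambda>s. flux n h s powr (1 / (p - 1)))}"

definition Lop :: "nat \<Rightarrow> real \<Rightarrow> (real \<Rightarrow> real) \<Rightarrow> real \<Rightarrow> real" where
  "Lop n p h r = (LINT s:{r..}|lebesgue. flux n h s powr (1 / (p - 1)))"

definition Qset :: "nat \<Rightarrow> real \<Rightarrow> real \<Rightarrow> real \<Rightarrow> real \<Rightarrow> (real \<Rightarrow> real) set" where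
  "Qset n p l \<xi>\<^sub>1 \<xi>\<^sub>2 = {g. g \<in> Lambda n p \<and> C1_halfline g \<and>
     (\<forall>r\<ge>0. inverse \<xi>\<^sub>1 * profile n p l r \<le> g r \<and> g r \<le> \<xi>\<^sub>1 \<and> \<bar>dhalf g r\<bar> \<le> \<xi>\<^sub>2)}"

definition Kop ::
  "(real \<times> real \<times> real \<Rightarrow> real) \<Rightarrow> real \<Rightarrow> (real \<Rightarrow> real) \<Rightarrow> real \<Rightarrow> real" where
  "Kop F \<beta> g r = F (r, g r, \<bar>dhalf g r\<bar>) * g r powr (- \<beta>)"

definition Top ::
  "nat \<Rightarrow> real \<Rightarrow> (real \<times> real \<times> real \<Rightarrow> real) \<Rightarrow> real \<Rightarrow> (real \<Rightarrow> real) \<Rightarrow> real \<Rightarrow> real" where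
  "Top n p F \<beta> g = Lop n p (Kop F \<beta> g)"

text \<open>
  Where an integral of \<open>H\<close> over \<open>[0,\<infinity>)\<close> might diverge, integrability is required explicitly. The
  integrands over bounded intervals are continuous and nonnegative by the regularity and sign
  conditions on \<open>F\<close> and \<open>\<phi>\<close>, so those integrals are always finite.
\<close>

definition admissible ::
  "nat \<Rightarrow> real \<Rightarrow> real \<Rightarrow> real \<Rightarrow> real \<Rightarrow> real \<Rightarrow>
   (real \<times> real \<times> real \<Rightarrow> real) \<Rightarrow> (real \<times> real \<Rightarrow> real) \<Rightarrow> real \<Rightarrow> bool" where
  "admissible n p \<alpha> l \<xi>\<^sub>1 \<xi>\<^sub>2 F \<phi> \<beta> \<longleftrightarrow>
     (let H = (\<lambda>t. F (t, \<xi>\<^sub>1, \<xi>\<^sub>2) * profile n p l t powr (- \<beta>)) in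
       (0 \<le> \<beta> \<and> \<beta> < p - 1 \<and> l powr (- ((real n - p) / (p - 1))) \<le> \<xi>\<^sub>1\<^sup>2) \<and>
       (locally_holder_on \<alpha> ({0..} \<times> {0..} \<times> {0..}) F \<and>
        continuous_on ({0..} \<times> {0..}) \<phi> \<and>
        (\<forall>r u \<rho>. 0 \<le> r \<and> 0 < u \<and> u \<le> \<xi>\<^sub>1 \<and> 0 \<le> \<rho> \<and> \<rho> \<le> \<xi>\<^sub>2 \<longrightarrow>
            0 \<le> \<phi> (r, u) \<and> \<phi> (r, u) \<le> F (r, u, \<rho>))) \<and>
       (\<forall>r\<ge>0. mono_on {0..\<xi>\<^sub>1} (\<lambda>u. \<phi> (r, u)) \<and>
          (\<forall>\<rho>\<in>{0..\<xi>\<^sub>2}. mono_on {0..\<xi>\<^sub>1} (\<lambda>u. F (r, u, \<rho>))) \<and>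
          (\<forall>u\<in>{0..\<xi>\<^sub>1}. mono_on {0..\<xi>\<^sub>2} (\<lambda>\<rho>. F (r, u, \<rho>)))) \<and>
       1 \<le> \<xi>\<^sub>1 powr (p - 1 - \<beta>) * ((p - 1) / (real n - p)) powr (p - 1) *
         (LINT t:{0..l}|lebesgue. t ^ (n - 1) * \<phi> (t, inverse \<xi>\<^sub>1 * profile n p l t)) \<and>
       (set_integrable lebesgue {0..} (\<lambda>s. flux n H s powr (1 / (p - 1))) \<and>
        (LINT s:{0..}|lebesgue. flux n H s powr (1 / (p - 1))) \<le> \<xi>\<^sub>1 powr (1 - \<beta> / (p - 1))) \<and>
       (\<forall>s>0. flux n H s \<le> \<xi>\<^sub>2 powr (p - 1) * \<xi>\<^sub>1 powr (- \<beta>)) \<and>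
       (\<exists>C>0. \<forall>r\<ge>0. H r < C) \<and>
       set_integrable lebesgue {0..} (\<lambda>t. t ^ (n - 1) * H t))"

end

theory Submission
  imports Defs "HOL-Complex_Analysis.Great_Picard"
begin

text \<open>
  Write \<open>\<psi>\<close> for the profile. Truncate \<open>F\<close> by clipping its second argument to
  \<open>[\<xi>\<^sub>1\<^sup>-\<^sup>1 \<psi>, \<xi>\<^sub>1]\<close> and its third to \<open>[0, \<xi>\<^sub>2]\<close>. By monotonicity every truncated source \<open>h\<close> satisfies
  \<open>0 \<le> h \<le> B\<close> with \<open>B = \<xi>\<^sub>1\<^sup>\<beta> F(\<cdot>, \<xi>\<^sub>1, \<xi>\<^sub>2) \<psi>\<^sup>-\<^sup>\<beta>\<close>, and conditions (3) to (5) put \<open>L\<^sub>h\<close> into the order and gradient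
  bounds of \<open>Q\<close>. So it suffices to solve the truncated equation, for which \<open>g = L\<^sub>h\<close> needs no a priori
  control.

  Instead of Schauder's theorem we use Tonelli's delay and a one-dimensional shooting argument. For a
  prescribed height \<open>a = g(0)\<close>, evaluating the source at the delayed time \<open>t - \<delta>\<close> makes the
  initial value problem uniquely solvable by finitely many iterations on bounded intervals, with
  continuous dependence on \<open>a\<close>; the intermediate value theorem provides \<open>a\<close> with
  \<open>g(\<infinity>) = 0\<close>. As the source is bounded, the fluxes \<open>s\<^sup>1\<^sup>-\<^sup>n \<integral>\<^sub>0\<^sup>s t\<^sup>n\<^sup>-\<^sup>1 h\<close> are Lipschitz uniformly in
  \<open>\<delta>\<close>, so a subsequence converges for \<open>\<delta> \<rightarrow> 0\<close>, and dominated convergence passes to the limit in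
  the equation. Finally \<open>g \<in> \<Lambda>\<close> since \<open>g\<close> decays like \<open>r\<close> to the power \<open>-(n - p)/(p - 1)\<close>
  and \<open>(n - p)/(p - 1) > p\<close> is equivalent to \<open>p\<^sup>2 < n\<close>.
\<close>

section \<open>Integrals over half-lines and fluxes\<close>

lemma set_borel_measurable_lebesgue_continuous:
  fixes f :: "real \<Rightarrow> real"
  assumes "S \<in> sets lebesgue" "continuous_on S f"
  shows "set_borel_measurable lebesgue S f"
proof -
  have "f \<in> borel_measurable (lebesgue_on S)"
    using assms by (simp add: continuous_imp_measurable_on_sets_lebesgue)
  then show ?thesis
    using assms(1) by (simp add: set_borel_measurable_def borel_measurable_restrict_space_iff)
qed

lemma set_integral_dominated_convergence:
  fixes f :: "real \<Rightarrow> real"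
  assumes S: "S \<in> sets lebesgue"
    and "\<And>i. continuous_on S (u i)" "continuous_on S f"
    and w: "set_integrable lebesgue S w"
    and lim: "\<And>x. x \<in> S \<Longrightarrow> (\<lambda>i::nat. u i x) \<longlonglongrightarrow> f x"
    and bound: "\<And>i x. x \<in> S \<Longrightarrow> \<bar>u i x\<bar> \<le> w x"
  shows "(\<lambda>i. LINT x:S|lebesgue. u i x) \<longlonglongrightarrow> (LINT x:S|lebesgue. f x)"
  unfolding set_lebesgue_integral_def
proof (rule integral_dominated_convergence)
  show "(\<lambda>x. indicat_real S x *\<^sub>R f x) \<in> borel_measurable lebesgue"
    "\<And>i. (\<lambda>x. indicat_real S x *\<^sub>R u i x) \<in> borel_measurable lebesgue"
    using set_borel_measurable_lebesgue_continuous[OF S] assms(2,3)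
    unfolding set_borel_measurable_def by auto
  show "integrable lebesgue (\<lambda>x. indicat_real S x *\<^sub>R w x)"
    using w by (simp add: set_integrable_def)
  show "AE x in lebesgue. (\<lambda>i. indicat_real S x *\<^sub>R u i x) \<longlonglongrightarrow> indicat_real S x *\<^sub>R f x"
    by (auto intro!: AE_I2 lim simp: indicator_def)
  show "\<And>i. AE x in lebesgue. norm (indicat_real S x *\<^sub>R u i x) \<le> indicat_real S x *\<^sub>R w x"
    by (auto intro!: AE_I2 bound simp: indicator_def)
qed

lemma set_integrable_dominated:
  fixes f :: "real \<Rightarrow> real"
  assumes "S \<in> sets lebesgue" "continuous_on S f" "set_integrable lebesgue S w"
    and "\<And>x. x \<in> S \<Longrightarrow> \<bar>f x\<bar> \<le> w x"
  shows "set_integrable lebesgue S f"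
  using assms(3)
proof (rule set_integrable_bound)
  show "set_borel_measurable lebesgue S f"
    using assms set_borel_measurable_lebesgue_continuous by blast
  show "AE x in lebesgue. x \<in> S \<longrightarrow> norm (f x) \<le> norm (w x)"
    using assms(4) by (force intro: AE_I2)
qed

lemma set_integral_nonneg:
  fixes f :: "real \<Rightarrow> real"
  assumes "\<And>x. x \<in> S \<Longrightarrow> 0 \<le> f x"
  shows "0 \<le> (LINT x:S|M. f x)"
  unfolding set_lebesgue_integral_def
  using assms by (intro Bochner_Integration.integral_nonneg) (auto simp: indicator_def)

lemma set_integral_split:
  fixes f :: "real \<Rightarrow> real"
  assumes "set_integrable lebesgue {a..} f" "a \<le> b"
  shows "(LINT x:{a..}|lebesgue. f x) = (LINT x:{a..b}|lebesgue. f x) + (LINT x:{b..}|lebesgue. f x)"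
proof -
  \<comment> \<open>The two pieces overlap only in the null set {b}.\<close>
  have "AE x in lebesgue. x \<noteq> b"
    by (rule AE_I'[of "{b}"]) (auto simp: negligible_iff_null_sets[symmetric])
  then have "AE x in lebesgue. \<not> (x \<in> {a..b} \<and> x \<in> {b..})"
    by eventually_elim auto
  moreover have "{a..} = {a..b} \<union> {b..}"
    using assms(2) by auto
  moreover have "set_integrable lebesgue {a..b} f" "set_integrable lebesgue {b..} f"
    using assms by (auto intro: set_integrable_subset[OF assms(1)])
  ultimately show ?thesis
    using set_integral_Un_AE[where A="{a..b}" and B="{b..}" and M=lebesgue and f=f] by simp
qed

section \<open>Fluxes: monotonicity, Lipschitz bound and limits\<close>

lemma flux_0 [simp]: "flux n h 0 = 0"
  by (simp add: flux_def)

lemma flux_cong: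
  assumes "\<And>t. 0 \<le> t \<Longrightarrow> t \<le> s \<Longrightarrow> h t = h' t"
  shows "flux n h s = flux n h' s"
  unfolding flux_def by (intro arg_cong2[where f="(*)"] set_lebesgue_integral_cong) (use assms in auto)

lemma flux_scale: "flux n (\<lambda>t. c * h t) s = c * flux n h s"
  by (simp add: flux_def mult.left_commute)

lemma moment_continuous:
  assumes "continuous_on {0..} h"
  shows "continuous_on {0..s} (\<lambda>t::real. t ^ (n - 1) * h t)"
  using assms by (intro continuous_intros) (auto elim: continuous_on_subset)

lemma moment_integrable:
  fixes h :: "real \<Rightarrow> real"
  assumes "continuous_on {0..} h" "0 \<le> r"
  shows "set_integrable lebesgue {r..s} (\<lambda>t. t ^ (n - 1) * h t)"
  using assms by (intro absolutely_integrable_continuous_real continuous_on_subset[OF moment_continuous[of h s n]]) auto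

lemma moment_mono:
  fixes h :: "real \<Rightarrow> real"
  assumes "continuous_on {0..} h" "\<And>t. 0 \<le> t \<Longrightarrow> 0 \<le> h t" "0 \<le> r" "r \<le> s"
  shows "(LINT t:{0..r}|lebesgue. t ^ (n - 1) * h t) \<le> (LINT t:{0..s}|lebesgue. t ^ (n - 1) * h t)"
  unfolding set_lebesgue_integral_def
proof (rule Bochner_Integration.integral_mono)
  show "integrable lebesgue (\<lambda>x. indicat_real {0..r} x *\<^sub>R (x ^ (n - 1) * h x))"
    "integrable lebesgue (\<lambda>x. indicat_real {0..s} x *\<^sub>R (x ^ (n - 1) * h x))"
    using moment_integrable[OF assms(1) order_refl] by (simp_all add: set_integrable_def)
qed (use assms in \<open>auto simp: indicator_def\<close>)

lemma flux_nonneg: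
  assumes "\<And>t. 0 \<le> t \<Longrightarrow> 0 \<le> h t"
  shows "0 \<le> flux n h s"
  unfolding flux_def using assms by (intro mult_nonneg_nonneg set_integral_nonneg) auto

lemma flux_mono:
  assumes "continuous_on {0..} h" "continuous_on {0..} h'"
    and "\<And>t. 0 \<le> t \<Longrightarrow> h t \<le> h' t"
  shows "flux n h s \<le> flux n h' s"
  unfolding flux_def
  by (intro mult_left_mono set_integral_mono moment_integrable assms) (use assms in auto)

text \<open>Passing from s to r acts on the flux in two opposite ways: the moment gains the mass on
  [s, r], and the weight r^(1-n) shrinks. With 0 <= h <= C the gain is at most C (r - s), and by
  Bernoulli's inequality the loss is at most (n - 1) C (r - s).\<close>

lemma flux_Lipschitz:
  assumes n: "n \<ge> 1" and cont: "continuous_on {0..} h"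
    and bd: "\<And>t. 0 \<le> t \<Longrightarrow> 0 \<le> h t \<and> h t \<le> C" and "0 \<le> s" "s \<le> r"
  shows "\<bar>flux n h r - flux n h s\<bar> \<le> real n * C * (r - s)"
proof -
  define W where "W a b = (LINT t:{a..b}|lebesgue. t ^ (n - 1) * h t)" for a b
  have W: "0 \<le> W a b" "W a b \<le> b ^ (n - 1) * C * (b - a)" if "0 \<le> a" "a \<le> b" for a b
  proof -
    show "0 \<le> W a b"
      unfolding W_def using that bd by (intro set_integral_nonneg) auto
    have "W a b \<le> (LINT t:{a..b}|lebesgue. b ^ (n - 1) * C)"
      unfolding W_def
      by (intro set_integral_mono moment_integrable cont absolutely_integrable_continuous_real
          mult_mono power_mono) (use that bd in auto)
    also have "\<dots> = b ^ (n - 1) * C * (b - a)"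
      using that by (simp add: set_lebesgue_integral_eq_integral absolutely_integrable_continuous_real)
    finally show "W a b \<le> b ^ (n - 1) * C * (b - a)" .
  qed
  have flux: "flux n h x = W 0 x / x ^ (n - 1)" if "0 < x" for x
  proof -
    have "x powr (1 - real n) = 1 / x ^ (n - 1)"
      using that n by (simp add: powr_diff powr_realpow power_diff divide_simps flip: powr_add)
    then show ?thesis
      by (simp add: flux_def W_def)
  qed
  have C: "0 \<le> C"
    using bd[of 0] by auto
  show ?thesis
  proof (cases "s = 0")
    case True
    show ?thesis
    proof (cases "r = 0")
      case False
      with assms have r: "r > 0" by auto
      \<comment> \<open>The flux vanishes at 0 because \<open>0 powr x = 0\<close>, and at r it is
        at most C r because t^(n-1) <= r^(n-1) under the integral.\<close>
      have "\<bar>flux n h r\<bar> \<le> C * r"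
        using W[of 0 r] r by (simp add: flux divide_simps mult_ac)
      also have "\<dots> \<le> real n * (C * r)"
        using mult_right_mono[of 1 "real n" "C * r"] n C r by auto
      finally show ?thesis
        using True by (simp add: mult_ac)
    qed (use True in auto)
  next
    case False
    with assms have s: "0 < s" "0 < r" by auto
    have split: "W 0 r = W 0 s + W s r"
    proof -
      have 1: "W a b = integral {a..b} (\<lambda>t. t ^ (n - 1) * h t)" if "0 \<le> a" for a b
        unfolding W_def using that cont by (intro set_lebesgue_integral_eq_integral moment_integrable)
      have "(\<lambda>t. t ^ (n - 1) * h t) integrable_on {0..r}"
        by (intro set_lebesgue_integral_eq_integral(1) moment_integrable cont order_refl)
      then show ?thesis
        unfolding 1[OF order_refl] 1[OF assms(4)]
        by (intro Henstock_Kurzweil_Integration.integral_combine[symmetric] assms)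
    qed
    \<comment> \<open>\<open>A\<close> is the gain from the mass on [s, r]; \<open>D\<close> is the
      loss from dividing the old mass by r^(n-1) instead of s^(n-1).\<close>
    define A where "A = W s r / r ^ (n - 1)"
    define D where "D = W 0 s / s ^ (n - 1) - W 0 s / r ^ (n - 1)"
    have "0 \<le> A" "A \<le> C * (r - s)"
      using W[of s r] assms(4,5) s by (auto simp: A_def divide_simps mult_ac)
    moreover have "0 \<le> D"
      unfolding D_def using W[of 0 s] s assms(4,5) by (auto intro!: divide_left_mono power_mono)
    moreover have "D \<le> (real n - 1) * C * (r - s)"
    proof -
      have D: "D = W 0 s / s ^ (n - 1) * (1 - (s / r) ^ (n - 1))"
        using s by (simp add: D_def divide_simps power_divide) (simp add: algebra_simps)
      \<comment> \<open>Bernoulli at s/r - 1 >= -1; it makes the loss linear in r - s.\<close>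
      have "1 + real (n - 1) * (s / r - 1) \<le> (1 + (s / r - 1)) ^ (n - 1)"
        using s by (intro Bernoulli_inequality) auto
      then have b: "1 - (s / r) ^ (n - 1) \<le> (real n - 1) * (1 - s / r)"
        using n by (simp add: of_nat_diff algebra_simps)
      have c: "W 0 s / s ^ (n - 1) \<le> C * s"
        using W[of 0 s] s by (simp add: divide_simps mult_ac)
      have "D \<le> (C * s) * ((real n - 1) * (1 - s / r))"
        unfolding D using b c C s assms(4,5) W[of 0 s]
        by (intro mult_mono) (auto simp: power_le_one)
      also have "\<dots> = (real n - 1) * C * ((s / r) * (r - s))"
        using s by (simp add: field_simps)
      also have "\<dots> \<le> (real n - 1) * C * (1 * (r - s))"
        using s assms(4,5) n C by (intro mult_left_mono mult_right_mono) auto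
      finally show ?thesis by simp
    qed
    moreover have "flux n h r - flux n h s = A - D"
      using s by (simp add: flux A_def D_def split add_divide_distrib)
    moreover have "(real n - 1) * C * (r - s) \<le> real n * C * (r - s)" "C * (r - s) \<le> real n * C * (r - s)"
      using n C assms(4,5) mult_right_mono[of 1 "real n" "C * (r - s)"]
        mult_right_mono[of "real n - 1" "real n" "C * (r - s)"] by (auto simp: mult.assoc)
    ultimately show ?thesis
      by linarith
  qed
qed

lemma flux_continuous:
  assumes "n \<ge> 1" "continuous_on {0..} h" "\<And>t. 0 \<le> t \<Longrightarrow> 0 \<le> h t \<and> h t \<le> C"
  shows "continuous_on {0..} (flux n h)"
proof -
  have "(real n * C)-lipschitz_on {0..} (flux n h)"
  proof (rule lipschitz_onI)
    have "0 \<le> C"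
      using assms(3)[of 0] by auto
    then show "0 \<le> real n * C" by simp
    fix x y :: real
    assume "x \<in> {0..}" "y \<in> {0..}"
    then show "dist (flux n h x) (flux n h y) \<le> real n * C * dist x y"
      using flux_Lipschitz[OF assms, where s=x and r=y] flux_Lipschitz[OF assms, where s=y and r=x]
      by (cases "x \<le> y") (auto simp: dist_real_def abs_minus_commute)
  qed
  then show ?thesis
    by (rule lipschitz_on_continuous_on)
qed

lemma flux_tendsto:
  assumes "\<And>i. continuous_on {0..} (h i)" "continuous_on {0..} h'" "continuous_on {0..} b"
    and "\<And>i t. 0 \<le> t \<Longrightarrow> 0 \<le> h i t \<and> h i t \<le> b t"
    and "\<And>t. 0 \<le> t \<Longrightarrow> (\<lambda>i::nat. h i t) \<longlonglongrightarrow> h' t"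
  shows "(\<lambda>i. flux n (h i) s) \<longlonglongrightarrow> flux n h' s"
  unfolding flux_def
proof (intro tendsto_mult tendsto_const set_integral_dominated_convergence)
  show "set_integrable lebesgue {0..s} (\<lambda>t. t ^ (n - 1) * b t)"
    by (intro moment_integrable assms) auto
  show "\<bar>x ^ (n - 1) * h i x\<bar> \<le> x ^ (n - 1) * b x" if "x \<in> {0..s}" for i x
    using that assms(4)[of x i] by (auto simp: abs_mult intro!: mult_left_mono)
  show "continuous_on {0..s} (\<lambda>t. t ^ (n - 1) * h i t)" "continuous_on {0..s} (\<lambda>t. t ^ (n - 1) * h' t)" for i
    by (intro moment_continuous assms)+
  show "(\<lambda>i. h i x) \<longlonglongrightarrow> h' x" if "x \<in> {0..s}" for x
    using that by (intro assms) auto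
qed auto

text \<open>The Holder estimate is given on compact subsets; a convergent sequence together with its
  limit is one, which yields sequential continuity.\<close>

lemma locally_holder_on_imp_continuous_on:
  fixes f :: "'a::heine_borel \<Rightarrow> 'b::metric_space"
  assumes hol: "locally_holder_on \<alpha> S f" and \<alpha>: "0 < \<alpha>"
  shows "continuous_on S f"
  unfolding continuous_on_sequentially
proof (intro allI ballI impI)
  fix x a
  assume a: "a \<in> S" and x: "(\<forall>n. x n \<in> S) \<and> x \<longlonglongrightarrow> a"
  define K where "K = insert a (range x)"
  have "compact K" "K \<subseteq> S"
    using a x compact_sequence_with_limit by (auto simp: K_def)
  then have "\<exists>C\<ge>0. \<forall>u\<in>K. \<forall>v\<in>K. dist (f u) (f v) \<le> C * dist u v powr \<alpha>"
    using hol by (simp add: locally_holder_on_def)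
  then obtain C where C: "\<forall>u\<in>K. \<forall>v\<in>K. dist (f u) (f v) \<le> C * dist u v powr \<alpha>"
    by auto
  have "(\<lambda>n. dist (x n) a) \<longlonglongrightarrow> 0"
    using x by (simp add: tendsto_dist_iff[symmetric])
  then have "(\<lambda>n. C * dist (x n) a powr \<alpha>) \<longlonglongrightarrow> C * 0 powr \<alpha>"
    using \<alpha> by (intro tendsto_intros tendsto_powr') auto
  then have lim: "(\<lambda>n. C * dist (x n) a powr \<alpha>) \<longlonglongrightarrow> 0"
    using \<alpha> by simp
  have "(\<lambda>n. dist (f (x n)) (f a)) \<longlonglongrightarrow> 0"
    by (rule Lim_null_comparison[OF _ lim]) (use C in \<open>auto simp: K_def\<close>)
  then show "(f \<circ> x) \<longlonglongrightarrow> f a"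
    by (subst tendsto_dist_iff) (simp add: o_def)
qed

section \<open>Tail integrals and a decay criterion for \<open>Lambda\<close>\<close>

lemma tail_integral_has_derivative:
  fixes w :: "real \<Rightarrow> real"
  assumes w: "continuous_on {0..} w" "set_integrable lebesgue {0..} w" and "0 \<le> x"
  shows "((\<lambda>r. LINT s:{r..}|lebesgue. w s) has_real_derivative - w x) (at x within {0..})"
proof -
  have *: "(LINT s:{r..}|lebesgue. w s) = (LINT s:{0..}|lebesgue. w s) - integral {0..r} w"
    if "0 \<le> r" for r
  proof -
    have "set_integrable lebesgue {0..r} w"
      by (rule set_integrable_subset[OF w(2)]) auto
    then show ?thesis
      using set_integral_split[OF w(2) that] by (simp add: set_lebesgue_integral_eq_integral)
  qed
  have cont: "continuous_on {0..x + 1} w"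
    using w(1) by (rule continuous_on_subset) auto
  have "((\<lambda>r. integral {0..r} w) has_real_derivative w x) (at x within {0..x + 1})"
    using cont assms(3) by (intro integral_has_real_derivative) auto
  \<comment> \<open>Near x both sets agree, so the fundamental theorem on a compact interval yields
    the derivative within the half-line, also at x = 0.\<close>
  moreover have "at x within {0..x + 1} = at x within {0..}"
    by (rule at_within_nhd[of x "{..<x + 1}"]) auto
  ultimately have "((\<lambda>r. (LINT s:{0..}|lebesgue. w s) - integral {0..r} w) has_real_derivative - w x)
      (at x within {0..})"
    using DERIV_diff[OF DERIV_const[of "LINT s:{0..}|lebesgue. w s"]] by fastforce
  then show ?thesis
    by (rule has_field_derivative_transform_within[where d=1]) (use assms(3) *[symmetric] in auto)
qed

lemma tail_integral_continuous:
  fixes w :: "real \<Rightarrow> real"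
  assumes "continuous_on {0..} w" "set_integrable lebesgue {0..} w"
  shows "continuous_on {0..} (\<lambda>r. LINT s:{r..}|lebesgue. w s)"
  using tail_integral_has_derivative[OF assms]
  by (intro DERIV_continuous_on) auto

lemma powr_tail_integral:
  fixes c e r :: real
  assumes "e < -1" "0 < r"
  shows "set_integrable lebesgue {r..} (\<lambda>s. c * s powr e)"
    and "(LINT s:{r..}|lebesgue. c * s powr e) = c * (- (r powr (e + 1)) / (e + 1))"
proof -
  note I = has_integral_powr_to_inf[OF assms]
  have "set_integrable lebesgue {r..} (\<lambda>s. s powr e)"
    using I by (intro nonnegative_absolutely_integrable_1) (auto simp: integrable_on_def)
  then show "set_integrable lebesgue {r..} (\<lambda>s. c * s powr e)"
    and "(LINT s:{r..}|lebesgue. c * s powr e) = c * (- (r powr (e + 1)) / (e + 1))"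
    using I by (auto simp: set_lebesgue_integral_eq_integral integral_unique)
qed

text \<open>The bounds on \<open>\<gamma>\<close> make the moments of \<open>g\<close> grow like \<open>s\<^sup>n\<^sup>-\<^sup>\<gamma>\<close> and the integrand of
  \<^const>\<open>Lop\<close> decay faster than \<open>s\<^sup>-\<^sup>1\<close>.\<close>

lemma Lambda_of_decay:
  assumes n: "n \<ge> 2" and p: "1 < p" and \<gamma>: "p < \<gamma>" "\<gamma> < real n"
    and g: "continuous_on {0..} g" "\<And>t. 0 \<le> t \<Longrightarrow> 0 \<le> g t \<and> g t \<le> X"
    and decay: "\<And>t. 0 < t \<Longrightarrow> g t \<le> D * t powr (- \<gamma>)" and D: "0 \<le> D"
  shows "g \<in> Lambda n p"
proof -
  define w where "w s = flux n g s powr (1 / (p - 1))" for s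
  have fn: "0 \<le> flux n g s" for s
    using g by (intro flux_nonneg) auto
  have "continuous_on {0..} (flux n g)"
    using n by (intro flux_continuous[OF _ g]) auto
  then have cw: "continuous_on {0..} w"
    unfolding w_def using p fn by (intro continuous_on_powr' continuous_intros) auto
  have fl: "flux n g s \<le> D / (real n - \<gamma>) * s powr (1 - \<gamma>)" if "0 < s" for s
  proof -
    \<comment> \<open>The exponent exceeds -1 because \<gamma> < n, so a possible singularity at 0
      is integrable.\<close>
    have "((\<lambda>t. t powr (real n - 1 - \<gamma>)) has_integral
        (s powr (real n - 1 - \<gamma> + 1) / (real n - 1 - \<gamma> + 1))) {0..s}"
      using \<gamma> that by (intro has_integral_powr_from_0) auto
    then have I: "((\<lambda>t. D * t powr (real n - 1 - \<gamma>)) has_integral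
        (D * (s powr (real n - \<gamma>) / (real n - \<gamma>)))) {0..s}"
      by (intro has_integral_mult_right) (simp add: algebra_simps)
    then have int: "set_integrable lebesgue {0..s} (\<lambda>t. D * t powr (real n - 1 - \<gamma>))"
      using D by (intro nonnegative_absolutely_integrable_1) (auto simp: integrable_on_def)
    have "(LINT t:{0..s}|lebesgue. t ^ (n - 1) * g t) \<le> (LINT t:{0..s}|lebesgue. D * t powr (real n - 1 - \<gamma>))"
    proof (intro set_integral_mono moment_integrable g int)
      fix t assume t: "t \<in> {0..s}"
      show "t ^ (n - 1) * g t \<le> D * t powr (real n - 1 - \<gamma>)"
      \<comment> \<open>The decay bound is only assumed for t > 0. At 0 both sides vanish, since n -
        1 >= 1 and \<open>0 powr x = 0\<close>.\<close>
      proof (cases "t = 0")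
        case False
        then have "t ^ (n - 1) * g t \<le> t ^ (n - 1) * (D * t powr (- \<gamma>))"
          using t decay[of t] by (intro mult_left_mono) auto
        also have "\<dots> = D * (t powr (real n - 1) * t powr (- \<gamma>))"
          using t False n by (simp add: powr_realpow[symmetric] of_nat_diff)
        also have "\<dots> = D * t powr (real n - 1 - \<gamma>)"
          by (simp add: powr_add[symmetric])
        finally show ?thesis .
      qed (use n in \<open>simp add: zero_power\<close>)
    qed auto
    also have "\<dots> = D * (s powr (real n - \<gamma>) / (real n - \<gamma>))"
      unfolding set_lebesgue_integral_eq_integral(2)[OF int] by (rule integral_unique[OF I])
    finally have "flux n g s \<le> s powr (1 - real n) * (D * (s powr (real n - \<gamma>) / (real n - \<gamma>)))"
      unfolding flux_def by (rule mult_left_mono) auto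
    also have "\<dots> = D / (real n - \<gamma>) * (s powr (1 - real n) * s powr (real n - \<gamma>))"
      by simp
    also have "\<dots> = D / (real n - \<gamma>) * s powr (1 - \<gamma>)"
      by (simp add: powr_add[symmetric])
    finally show ?thesis .
  qed
  have "set_integrable lebesgue {1..} w"
  proof (rule set_integrable_dominated)
    show "continuous_on {1..} w"
      using cw by (rule continuous_on_subset) auto
    \<comment> \<open>This inequality is p < \<gamma> in disguise.\<close>
    have "(1 - \<gamma>) * (1 / (p - 1)) < -1"
      using p \<gamma> by (simp add: divide_simps)
    then show "set_integrable lebesgue {1..}
        (\<lambda>s. (D / (real n - \<gamma>)) powr (1 / (p - 1)) * s powr ((1 - \<gamma>) * (1 / (p - 1))))"
      by (rule powr_tail_integral) auto
    fix s :: real assume "s \<in> {1..}"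
    then have "w s \<le> (D / (real n - \<gamma>) * s powr (1 - \<gamma>)) powr (1 / (p - 1))"
      unfolding w_def using p fn fl[of s] by (intro powr_mono2) auto
    also have "\<dots> = (D / (real n - \<gamma>)) powr (1 / (p - 1)) * s powr ((1 - \<gamma>) * (1 / (p - 1)))"
      using D \<gamma> by (subst powr_mult) (auto simp: powr_powr)
    finally show "\<bar>w s\<bar> \<le> \<dots>"
      by (simp add: w_def)
  qed auto
  moreover have "set_integrable lebesgue {0..1} w"
    by (intro absolutely_integrable_continuous_real continuous_on_subset[OF cw]) auto
  moreover have "{0..} = {0..1} \<union> {1::real..}"
    by auto
  ultimately have "set_integrable lebesgue {0..} w"
    using set_integrable_Un[of lebesgue "{0..1}" w "{1..}"] by simp
  moreover have "g \<in> borel_measurable (lebesgue_on {0..})"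
    using g by (intro continuous_imp_measurable_on_sets_lebesgue) auto
  ultimately show ?thesis
    unfolding w_def using g(2) moment_integrable[OF g(1) order_refl] by (simp add: Lambda_def w_def[abs_def])
qed

section \<open>The truncated problem\<close>

locale admissible_data =
  fixes n :: nat and p \<alpha> l \<xi>\<^sub>1 \<xi>\<^sub>2 \<beta> :: real
    and F :: "real \<times> real \<times> real \<Rightarrow> real" and \<phi> :: "real \<times> real \<Rightarrow> real"
  assumes n_ge_2: "n \<ge> 2"
    and p_gt_1: "1 < p" and p_less: "p < min 2 (sqrt (real n))"
    and \<alpha>_pos: "0 < \<alpha>"
    and l_pos: "0 < l" and \<xi>\<^sub>1_pos: "0 < \<xi>\<^sub>1" and \<xi>\<^sub>2_pos: "0 < \<xi>\<^sub>2"
    and admissible: "admissible n p \<alpha> l \<xi>\<^sub>1 \<xi>\<^sub>2 F \<phi> \<beta>"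
begin

abbreviation "prof \<equiv> profile n p l"
abbreviation "q \<equiv> 1 / (p - 1)"

definition "H t = F (t, \<xi>\<^sub>1, \<xi>\<^sub>2) * prof t powr (- \<beta>)"
text \<open>The factor \<open>\<xi>\<^sub>1 powr \<beta>\<close> comes from raising the lower
  barrier \<open>inverse \<xi>\<^sub>1 * prof t\<close> to the power -\<beta>.\<close>

definition "B t = \<xi>\<^sub>1 powr \<beta> * H t"
text \<open>The integrand of \<open>Lop\<close>; for the sources considered here it is minus the
  derivative of \<open>Lop n p h\<close> on the half-line.\<close>

definition "P h s = flux n h s powr q"
text \<open>Taking the maximum last keeps the value at or above the positive lower barrier for every
  real \<open>u\<close>, so a negative power of it is harmless.\<close>

definition "clip t u = max (inverse \<xi>\<^sub>1 * prof t) (min \<xi>\<^sub>1 u)"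
text \<open>The argument \<open>\<rho>\<close> stands for |g'|, so it is truncated from above
  only.\<close>

definition "K t u \<rho> = F (t, clip t u, min \<xi>\<^sub>2 \<rho>) * clip t u powr (- \<beta>)"
text \<open>The invariant class of sources: the consequences of (4) to (7) for \<open>B\<close> pass
  to all its members.\<close>

definition "dominated h \<longleftrightarrow> continuous_on {0..} h \<and> (\<forall>t\<ge>0. 0 \<le> h t \<and> h t \<le> B t)"

section \<open>Consequences of the hypotheses on the data\<close>

lemma n_ge_1: "1 \<le> n"
  using n_ge_2 by simp

lemma p_square_less: "p\<^sup>2 < real n"
proof -
  have "p < sqrt (real n)"
    using p_less by simp
  then have "p\<^sup>2 < (sqrt (real n))\<^sup>2"
    using p_gt_1 by (intro power_strict_mono) auto
  then show ?thesis by simp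
qed

lemma p_less_n: "p < real n"
  using p_less n_ge_2 by simp

lemma q_pos: "0 < q"
  using p_gt_1 by simp

lemmas adm = admissible[unfolded admissible_def Let_def, folded H_def]

lemma \<beta>: "0 \<le> \<beta>" "\<beta> < p - 1"
  and l_powr_le: "l powr (- ((real n - p) / (p - 1))) \<le> \<xi>\<^sub>1\<^sup>2"
  and holder: "locally_holder_on \<alpha> ({0..} \<times> {0..} \<times> {0..}) F"
  and \<phi>_cont: "continuous_on ({0..} \<times> {0..}) \<phi>"
  using adm by blast+

lemma F_bounds:
  assumes "0 \<le> r" "0 < u" "u \<le> \<xi>\<^sub>1" "0 \<le> \<rho>" "\<rho> \<le> \<xi>\<^sub>2"
  shows "0 \<le> \<phi> (r, u)" "\<phi> (r, u) \<le> F (r, u, \<rho>)"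
  using adm assms by blast+

lemma \<phi>_mono: "0 \<le> r \<Longrightarrow> mono_on {0..\<xi>\<^sub>1} (\<lambda>u. \<phi> (r, u))"
  and F_mono_u: "0 \<le> r \<Longrightarrow> \<rho> \<in> {0..\<xi>\<^sub>2} \<Longrightarrow> mono_on {0..\<xi>\<^sub>1} (\<lambda>u. F (r, u, \<rho>))"
  and F_mono_\<rho>: "0 \<le> r \<Longrightarrow> u \<in> {0..\<xi>\<^sub>1} \<Longrightarrow> mono_on {0..\<xi>\<^sub>2} (\<lambda>\<rho>. F (r, u, \<rho>))"
  using adm by blast+

lemma H_eq: "(\<lambda>t. F (t, \<xi>\<^sub>1, \<xi>\<^sub>2) * prof t powr (- \<beta>)) = H"
  by (simp add: H_def[abs_def])

lemma \<phi>_moment: "1 \<le> \<xi>\<^sub>1 powr (p - 1 - \<beta>) * ((p - 1) / (real n - p)) powr (p - 1) *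
    (LINT t:{0..l}|lebesgue. t ^ (n - 1) * \<phi> (t, inverse \<xi>\<^sub>1 * prof t))"
  using adm by blast

lemma flux_H_integrable: "set_integrable lebesgue {0..} (\<lambda>s. flux n H s powr q)"
  and flux_H_integral: "(LINT s:{0..}|lebesgue. flux n H s powr q) \<le> \<xi>\<^sub>1 powr (1 - \<beta> / (p - 1))"
  and flux_H_le: "0 < s \<Longrightarrow> flux n H s \<le> \<xi>\<^sub>2 powr (p - 1) * \<xi>\<^sub>1 powr (- \<beta>)"
  and H_bounded: "\<exists>C>0. \<forall>r\<ge>0. H r < C"
  and H_moment: "set_integrable lebesgue {0..} (\<lambda>t. t ^ (n - 1) * H t)"
  using admissible[unfolded admissible_def Let_def H_eq] by (auto simp: H_def)

lemma prof_pos [simp]: "0 < prof t"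
  using l_pos by (simp add: profile_def)

text \<open>Makes the clipping interval nonempty: the profile is largest on [0, l], where condition
  (0) bounds it by the square of \<open>\<xi>\<^sub>1\<close>.\<close>

lemma prof_le: "inverse \<xi>\<^sub>1 * prof t \<le> \<xi>\<^sub>1"
proof -
  have "prof t \<le> l powr (- ((real n - p) / (p - 1)))"
    unfolding profile_def using l_pos p_less_n p_gt_1 by (intro powr_mono2') auto
  also have "\<dots> \<le> \<xi>\<^sub>1\<^sup>2"
    by (rule l_powr_le)
  finally show ?thesis
    using \<xi>\<^sub>1_pos by (simp add: field_simps power2_eq_square)
qed

lemma prof_continuous: "continuous_on S prof"
  unfolding profile_def[abs_def] using l_pos by (intro continuous_intros) auto

lemma F_continuous: "continuous_on ({0..} \<times> {0..} \<times> {0..}) F"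
  using holder \<alpha>_pos by (rule locally_holder_on_imp_continuous_on)

section \<open>The truncated source: continuity and bounds\<close>

lemma clip: "inverse \<xi>\<^sub>1 * prof t \<le> clip t u" "clip t u \<le> \<xi>\<^sub>1" "0 < clip t u"
  using prof_le[of t] \<xi>\<^sub>1_pos prof_pos[of t]
  by (auto simp: clip_def less_max_iff_disj simp del: prof_pos)

text \<open>The second argument ranges over all reals because a shooting height minus an integral
  may leave the range prescribed by \<open>Q\<close>. Clipping keeps the base of the power positive,
  which gives continuity.\<close>

lemma K_continuous: "continuous_on ({0..} \<times> UNIV \<times> {0..}) (\<lambda>(t, u, \<rho>). K t u \<rho>)"
proof -
  have c: "continuous_on S (\<lambda>x. clip (fst x) (fst (snd x)))" for S :: "(real \<times> real \<times> real) set"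
    unfolding clip_def
    by (intro continuous_intros continuous_on_compose2[OF prof_continuous[of UNIV]]) auto
  have "continuous_on ({0..} \<times> UNIV \<times> {0..})
      (\<lambda>x. F (fst x, clip (fst x) (fst (snd x)), min \<xi>\<^sub>2 (snd (snd x))))"
    using clip(3) \<xi>\<^sub>2_pos
    by (intro continuous_on_compose2[OF F_continuous] continuous_intros c) (auto intro: less_imp_le)
  moreover have "continuous_on ({0..} \<times> UNIV \<times> {0::real..}) (\<lambda>x. clip (fst x) (fst (snd x)) powr (- \<beta>))"
    by (intro continuous_on_powr c continuous_on_const) (simp add: less_imp_neq[OF clip(3), symmetric])
  ultimately show ?thesis
    by (simp add: K_def case_prod_unfold continuous_on_mult)
qed

lemma K_compose_continuous:
  assumes "continuous_on {0..} u" "continuous_on {0..} \<rho>" "\<And>t. 0 \<le> t \<Longrightarrow> 0 \<le> \<rho> t"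
  shows "continuous_on {0..} (\<lambda>t. K t (u t) (\<rho> t))"
proof -
  have "continuous_on {0..} (\<lambda>t. (t, u t, \<rho> t))"
    by (intro continuous_on_Pair continuous_on_id assms)
  moreover have "(\<lambda>t. (t, u t, \<rho> t)) ` {0..} \<subseteq> {0..} \<times> UNIV \<times> {0..}"
    using assms(3) by auto
  ultimately have "continuous_on {0..} (\<lambda>t. case (t, u t, \<rho> t) of (t, u, \<rho>) \<Rightarrow> K t u \<rho>)"
    by (rule continuous_on_compose2[OF K_continuous])
  then show ?thesis by simp
qed

lemma K_tendsto:
  assumes "0 \<le> t" "u \<longlonglongrightarrow> u'" "\<rho> \<longlonglongrightarrow> \<rho>'" "\<And>i::nat. 0 \<le> \<rho> i"
  shows "(\<lambda>i. K t (u i) (\<rho> i)) \<longlonglongrightarrow> K t u' \<rho>'"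
proof -
  have "0 \<le> \<rho>'"
    using assms(3,4) by (intro LIMSEQ_le_const) auto
  moreover have "(\<lambda>i. (t, u i, \<rho> i)) \<longlonglongrightarrow> (t, u', \<rho>')"
    by (intro tendsto_Pair tendsto_const assms)
  ultimately show ?thesis
    using continuous_on_tendsto_compose[OF K_continuous, of "\<lambda>i. (t, u i, \<rho> i)" "(t, u', \<rho>')" sequentially]
      assms(1,4) by simp
qed

text \<open>\<open>F\<close> increases and the power with exponent -\<beta> decreases in the clipped
  value, so the two factors are bounded separately at opposite ends of the clipping interval. For
  the lower bound, \<phi> <= F reduces the first factor to monotonicity of \<phi>.\<close>

lemma K_bounds:
  assumes t: "0 \<le> t" and \<rho>: "0 \<le> \<rho>"
  shows "0 \<le> K t u \<rho>" "K t u \<rho> \<le> B t"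
    and "\<xi>\<^sub>1 powr (- \<beta>) * \<phi> (t, inverse \<xi>\<^sub>1 * prof t) \<le> K t u \<rho>"
proof -
  let ?c = "clip t u" and ?\<rho> = "min \<xi>\<^sub>2 \<rho>"
  have r: "0 \<le> ?\<rho>" "?\<rho> \<le> \<xi>\<^sub>2"
    using \<rho> \<xi>\<^sub>2_pos by auto
  have i: "0 < inverse \<xi>\<^sub>1 * prof t"
    using \<xi>\<^sub>1_pos by simp
  have F0: "0 \<le> \<phi> (t, ?c)" "\<phi> (t, ?c) \<le> F (t, ?c, ?\<rho>)"
    using F_bounds[OF t clip(3) clip(2) r] .
  then show "0 \<le> K t u \<rho>"
    by (simp add: K_def)
  have "F (t, ?c, ?\<rho>) \<le> F (t, \<xi>\<^sub>1, ?\<rho>)"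
    using r clip[of t u] \<xi>\<^sub>1_pos by (intro mono_onD[OF F_mono_u[OF t]]) auto
  also have "\<dots> \<le> F (t, \<xi>\<^sub>1, \<xi>\<^sub>2)"
    using r \<xi>\<^sub>1_pos \<xi>\<^sub>2_pos by (intro mono_onD[OF F_mono_\<rho>[OF t]]) auto
  finally have "K t u \<rho> \<le> F (t, \<xi>\<^sub>1, \<xi>\<^sub>2) * (inverse \<xi>\<^sub>1 * prof t) powr (- \<beta>)"
    unfolding K_def using F0 clip[of t u] i \<beta>(1) by (intro mult_mono powr_mono2') auto
  also have "\<dots> = B t"
    using \<xi>\<^sub>1_pos prof_pos[of t] by (simp add: B_def H_def powr_mult powr_minus inverse_powr)
  finally show "K t u \<rho> \<le> B t" .
  have "\<phi> (t, inverse \<xi>\<^sub>1 * prof t) * \<xi>\<^sub>1 powr (- \<beta>) \<le> F (t, ?c, ?\<rho>) * ?c powr (- \<beta>)"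
  proof (rule mult_mono)
    have "\<phi> (t, inverse \<xi>\<^sub>1 * prof t) \<le> \<phi> (t, ?c)"
      using clip[of t u] prof_le[of t] \<xi>\<^sub>1_pos
      by (intro mono_onD[OF \<phi>_mono[OF t]]) (auto simp: less_imp_le[OF i])
    then show "\<phi> (t, inverse \<xi>\<^sub>1 * prof t) \<le> F (t, ?c, ?\<rho>)"
      using F0 by simp
    show "\<xi>\<^sub>1 powr (- \<beta>) \<le> ?c powr (- \<beta>)"
      using clip[of t u] \<beta>(1) by (intro powr_mono2') auto
  qed (use F0 in auto)
  then show "\<xi>\<^sub>1 powr (- \<beta>) * \<phi> (t, inverse \<xi>\<^sub>1 * prof t) \<le> K t u \<rho>"
    by (simp add: K_def mult.commute)
qed

lemma H_nonneg: "0 \<le> t \<Longrightarrow> 0 \<le> H t"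
  using F_bounds[of t \<xi>\<^sub>1 \<xi>\<^sub>2] \<xi>\<^sub>1_pos \<xi>\<^sub>2_pos by (simp add: H_def)

lemma B_nonneg: "0 \<le> t \<Longrightarrow> 0 \<le> B t"
  using H_nonneg by (simp add: B_def)

lemma B_continuous: "continuous_on {0..} B"
proof -
  have "continuous_on {0..} (\<lambda>t. F (t, \<xi>\<^sub>1, \<xi>\<^sub>2))"
    using \<xi>\<^sub>1_pos \<xi>\<^sub>2_pos by (intro continuous_on_compose2[OF F_continuous] continuous_intros) auto
  moreover have "continuous_on {0..} (\<lambda>t. prof t powr (- \<beta>))"
    by (rule continuous_on_powr[OF prof_continuous continuous_on_const])
      (simp add: less_imp_neq[OF prof_pos, symmetric])
  ultimately show ?thesis
    unfolding B_def[abs_def] H_def by (intro continuous_on_mult continuous_on_const)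
qed

section \<open>Dominated sources and the functions \<open>P h\<close> and
  \<open>Lop n p h\<close>\<close>

lemma dominated_0: "dominated (\<lambda>_. 0)"
  using B_nonneg by (simp add: dominated_def)

lemma P_nonneg [simp]: "0 \<le> P h s"
  by (simp add: P_def)

lemma P_B: "P B s = \<xi>\<^sub>1 powr (\<beta> * q) * flux n H s powr q"
proof -
  have "0 \<le> flux n H s"
    using H_nonneg by (rule flux_nonneg)
  moreover have "flux n B s = \<xi>\<^sub>1 powr \<beta> * flux n H s"
    unfolding B_def[abs_def] by (rule flux_scale)
  ultimately show ?thesis
    using \<xi>\<^sub>1_pos by (simp add: P_def powr_mult powr_powr)
qed

lemma P_B_integrable: "set_integrable lebesgue {0..} (P B)"
  unfolding P_B[abs_def] using flux_H_integrable by simp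

text \<open>Condition (4): the power of \<open>\<xi>\<^sub>1\<close> contained in \<open>B\<close>
  turns its right-hand side into exactly \<open>\<xi>\<^sub>1\<close>.\<close>

lemma P_B_integral: "(LINT s:{0..}|lebesgue. P B s) \<le> \<xi>\<^sub>1"
proof -
  have "(LINT s:{0..}|lebesgue. P B s) \<le> \<xi>\<^sub>1 powr (\<beta> * q) * \<xi>\<^sub>1 powr (1 - \<beta> / (p - 1))"
    unfolding P_B using flux_H_integral by (simp add: mult_left_mono)
  also have "\<dots> = \<xi>\<^sub>1"
    using \<xi>\<^sub>1_pos by (simp add: powr_add[symmetric])
  finally show ?thesis .
qed

text \<open>Condition (5) raised to the power 1/(p - 1), where the powers of
  \<open>\<xi>\<^sub>1\<close> cancel. That condition concerns s > 0; at 0 the flux is 0.\<close>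

lemma P_B_le: "0 \<le> s \<Longrightarrow> P B s \<le> \<xi>\<^sub>2"
proof (cases "s = 0")
  case False
  assume "0 \<le> s"
  with False have "P B s \<le> \<xi>\<^sub>1 powr (\<beta> * q) * (\<xi>\<^sub>2 powr (p - 1) * \<xi>\<^sub>1 powr (- \<beta>)) powr q"
    unfolding P_B using flux_H_le[of s] q_pos H_nonneg
    by (intro mult_left_mono powr_mono2 flux_nonneg) auto
  also have "\<dots> = \<xi>\<^sub>2 powr ((p - 1) * q)"
    using \<xi>\<^sub>1_pos \<xi>\<^sub>2_pos by (simp add: powr_mult powr_powr powr_add[symmetric] mult.left_commute)
  also have "\<dots> = \<xi>\<^sub>2"
    using p_gt_1 \<xi>\<^sub>2_pos by simp
  finally show ?thesis .
qed (use \<xi>\<^sub>2_pos in \<open>simp add: P_def\<close>)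

lemma dominatedD:
  assumes "dominated h"
  shows "continuous_on {0..} h" "0 \<le> t \<Longrightarrow> 0 \<le> h t" "0 \<le> t \<Longrightarrow> h t \<le> B t" "0 \<le> flux n h s"
    "P h s \<le> P B s" "0 \<le> s \<Longrightarrow> P h s \<le> \<xi>\<^sub>2"
proof -
  show h: "continuous_on {0..} h" "0 \<le> t \<Longrightarrow> 0 \<le> h t" "0 \<le> t \<Longrightarrow> h t \<le> B t" for t
    using assms by (auto simp: dominated_def)
  show f: "0 \<le> flux n h s"
    using h(2) by (rule flux_nonneg)
  have "flux n h s \<le> flux n B s"
    by (intro flux_mono h B_continuous)
  then show "P h s \<le> P B s"
    unfolding P_def using f q_pos by (intro powr_mono2) auto
  then show "0 \<le> s \<Longrightarrow> P h s \<le> \<xi>\<^sub>2"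
    using P_B_le[of s] by simp
qed

text \<open>Condition (6) bounds \<open>B\<close>, so one constant serves all dominated sources.
  This is the equicontinuity behind both the compactness argument and the removal of the
  delay.\<close>

lemma flux_dominated_Lipschitz:
  "\<exists>L\<ge>0. \<forall>h s r. dominated h \<longrightarrow> 0 \<le> s \<longrightarrow> s \<le> r \<longrightarrow>
    \<bar>flux n h r - flux n h s\<bar> \<le> L * (r - s)"
proof -
  obtain C where C0: "0 < C" and C: "\<And>t. 0 \<le> t \<Longrightarrow> H t < C"
    using H_bounded by auto
  have "\<bar>flux n h r - flux n h s\<bar> \<le> real n * (\<xi>\<^sub>1 powr \<beta> * C) * (r - s)"
    if h: "dominated h" and "0 \<le> s" "s \<le> r" for h s r
  proof (intro flux_Lipschitz n_ge_1 dominatedD(1)[OF h] that conjI)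
    fix t :: real
    assume t: "0 \<le> t"
    show "0 \<le> h t"
      using h t by (rule dominatedD)
    have "h t \<le> B t"
      using h t by (rule dominatedD)
    also have "\<dots> \<le> \<xi>\<^sub>1 powr \<beta> * C"
      unfolding B_def using C[OF t] by (intro mult_left_mono) auto
    finally show "h t \<le> \<xi>\<^sub>1 powr \<beta> * C" .
  qed
  moreover have "0 \<le> real n * (\<xi>\<^sub>1 powr \<beta> * C)"
    using C0 by simp
  ultimately show ?thesis by blast
qed

lemma P_continuous:
  assumes h: "dominated h"
  shows "continuous_on {0..} (P h)"
proof -
  obtain C where C: "\<And>t. 0 \<le> t \<Longrightarrow> H t < C"
    using H_bounded by auto
  have "h t \<le> \<xi>\<^sub>1 powr \<beta> * C" if "0 \<le> t" for t
    using dominatedD(3)[OF h that] mult_left_mono[OF less_imp_le[OF C[OF that]], of "\<xi>\<^sub>1 powr \<beta>"]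
    by (simp add: B_def)
  then have "continuous_on {0..} (flux n h)"
    using dominatedD(2)[OF h] by (intro flux_continuous n_ge_1 dominatedD(1)[OF h]) auto
  then show ?thesis
    unfolding P_def[abs_def] using p_gt_1 dominatedD(4)[OF h]
    by (intro continuous_on_powr' continuous_intros) auto
qed

lemma P_integrable:
  assumes "dominated h" "S \<in> sets lebesgue" "S \<subseteq> {0..}"
  shows "set_integrable lebesgue S (P h)"
proof (rule set_integrable_dominated)
  show "continuous_on S (P h)"
    using P_continuous[OF assms(1)] assms(3) by (rule continuous_on_subset)
  show "set_integrable lebesgue S (P B)"
    using P_B_integrable assms(2,3) by (rule set_integrable_subset)
qed (use assms dominatedD(5)[OF assms(1)] in auto)

lemma Lop_P: "Lop n p h r = (LINT s:{r..}|lebesgue. P h s)"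
  by (simp add: Lop_def P_def)

lemma Lop_nonneg: "0 \<le> Lop n p h r"
  unfolding Lop_P by (rule set_integral_nonneg) simp

lemma Lop_split:
  assumes "dominated h" "0 \<le> r" "r \<le> s"
  shows "Lop n p h r = (LINT x:{r..s}|lebesgue. P h x) + Lop n p h s"
  unfolding Lop_P using assms by (intro set_integral_split P_integrable) auto

lemma Lop_antimono:
  assumes "dominated h" "0 \<le> r" "r \<le> s"
  shows "Lop n p h s \<le> Lop n p h r"
  unfolding Lop_split[OF assms] using set_integral_nonneg[of "{r..s}" "P h"] by simp

text \<open>The decrease over [r, s] is the integral of \<open>P h\<close>, which condition (5)
  keeps between 0 and \<open>\<xi>\<^sub>2\<close>.\<close>

lemma Lop_Lipschitz:
  assumes "dominated h" "0 \<le> r" "r \<le> s"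
  shows "\<bar>Lop n p h r - Lop n p h s\<bar> \<le> \<xi>\<^sub>2 * (s - r)"
proof -
  have "(LINT x:{r..s}|lebesgue. P h x) \<le> (LINT x:{r..s}|lebesgue. \<xi>\<^sub>2)"
    using assms
    by (intro set_integral_mono P_integrable absolutely_integrable_continuous_real)
      (auto intro: dominatedD(6)[OF assms(1)])
  also have "\<dots> = \<xi>\<^sub>2 * (s - r)"
    using assms by (simp add: set_lebesgue_integral_eq_integral absolutely_integrable_continuous_real)
  finally show ?thesis
    using Lop_split[OF assms] Lop_antimono[OF assms] by simp
qed

text \<open>The largest value is at 0, where comparison with \<open>B\<close> and condition (4)
  apply.\<close>

lemma Lop_le:
  assumes "dominated h" "0 \<le> r"
  shows "Lop n p h r \<le> \<xi>\<^sub>1"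
proof -
  have "Lop n p h r \<le> Lop n p h 0"
    using assms by (intro Lop_antimono) auto
  also have "\<dots> \<le> (LINT s:{0..}|lebesgue. P B s)"
    unfolding Lop_P
    by (intro set_integral_mono P_integrable P_B_integrable assms dominatedD(5)) auto
  finally show ?thesis
    using P_B_integral by simp
qed

lemma P_tendsto:
  assumes "\<And>i::nat. dominated (h i)" "dominated h'" "\<And>t. 0 \<le> t \<Longrightarrow> (\<lambda>i. h i t) \<longlonglongrightarrow> h' t"
  shows "(\<lambda>i. P (h i) s) \<longlonglongrightarrow> P h' s"
proof -
  have "(\<lambda>i. flux n (h i) s) \<longlonglongrightarrow> flux n h' s"
    using dominatedD(2,3)[OF assms(1)]
    by (intro flux_tendsto[where b=B] B_continuous dominatedD(1) assms conjI)
  then show ?thesis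
    unfolding P_def using q_pos dominatedD(4)[OF assms(1)] by (intro tendsto_powr') auto
qed

text \<open>\<open>P B\<close> is integrable over the whole half-line, so it is a majorant even on
  unbounded \<open>S\<close>.\<close>

lemma P_integral_tendsto:
  assumes "\<And>i::nat. dominated (h i)" "dominated h'" "\<And>t. 0 \<le> t \<Longrightarrow> (\<lambda>i. h i t) \<longlonglongrightarrow> h' t"
    and S: "S \<in> sets lebesgue" "S \<subseteq> {0..}"
  shows "(\<lambda>i. LINT s:S|lebesgue. P (h i) s) \<longlonglongrightarrow> (LINT s:S|lebesgue. P h' s)"
proof (rule set_integral_dominated_convergence[OF S(1)])
  show "continuous_on S (P (h i))" for i
    using P_continuous[OF assms(1)] S(2) by (rule continuous_on_subset)
  show "continuous_on S (P h')"
    using P_continuous[OF assms(2)] S(2) by (rule continuous_on_subset)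
  show "set_integrable lebesgue S (P B)"
    using P_B_integrable S by (rule set_integrable_subset)
  show "(\<lambda>i. P (h i) x) \<longlonglongrightarrow> P h' x" for x
    by (rule P_tendsto[OF assms(1-3)])
  show "\<bar>P (h i) x\<bar> \<le> P B x" for i x
    using dominatedD(5)[OF assms(1)] by simp
qed

section \<open>Tonelli approximation\<close>

lemma Lop_continuous: "dominated h \<Longrightarrow> continuous_on {0..} (Lop n p h)"
  unfolding Lop_P[abs_def]
  by (intro tail_integral_continuous P_continuous P_integrable) auto

text \<open>Tonelli's delayed equation for the unknown \<open>h = K(\<cdot>, g, \<bar>g'\<bar>)\<close>, where \<open>g\<close> starts at height \<open>a\<close>.\<close>

definition delayed :: "real \<Rightarrow> real \<Rightarrow> (real \<Rightarrow> real) \<Rightarrow> real \<Rightarrow> real" where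
  "delayed \<delta> a h t = K t (a - (LINT s:{0..max 0 (t - \<delta>)}|lebesgue. P h s)) (P h (max 0 (t - \<delta>)))"

text \<open>Picard iterates from the zero source. Because of the delay they become stationary on
  each bounded interval after finitely many steps, so no limit in \<open>k\<close> is taken.\<close>

definition iter :: "real \<Rightarrow> real \<Rightarrow> nat \<Rightarrow> real \<Rightarrow> real" where
  "iter \<delta> a k = (delayed \<delta> a ^^ k) (\<lambda>_. 0)"

lemma iter_0 [simp]: "iter \<delta> a 0 t = 0"
  and iter_Suc: "iter \<delta> a (Suc k) = delayed \<delta> a (iter \<delta> a k)"
  by (simp_all add: iter_def)

text \<open>Prepares the shooting condition: once \<open>Lop n p h 0 = a\<close>, the height at the
  delayed time is the value of \<open>Lop n p h\<close> there, which tends to 0 at infinity.\<close>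

lemma delayed_Lop:
  assumes "dominated h"
  shows "delayed \<delta> a h t = K t (a - Lop n p h 0 + Lop n p h (max 0 (t - \<delta>))) (P h (max 0 (t - \<delta>)))"
  using Lop_split[OF assms order_refl, of "max 0 (t - \<delta>)"] by (simp add: delayed_def)

lemma dominated_delayed:
  assumes "dominated h"
  shows "dominated (delayed \<delta> a h)"
  unfolding dominated_def
proof (intro conjI allI impI)
  have "continuous_on {0..} (\<lambda>t. Lop n p h (max 0 (t - \<delta>)))" "continuous_on {0..} (\<lambda>t. P h (max 0 (t - \<delta>)))"
    by (intro continuous_on_compose2[OF Lop_continuous[OF assms]]
        continuous_on_compose2[OF P_continuous[OF assms]]; force intro!: continuous_intros)+
  then show "continuous_on {0..} (delayed \<delta> a h)"
    unfolding delayed_Lop[OF assms, abs_def]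
    by (intro K_compose_continuous continuous_on_add continuous_on_const P_nonneg)
qed (simp_all add: delayed_def K_bounds)

lemma dominated_iter: "dominated (iter \<delta> a k)"
  by (induction k) (auto simp: iter_Suc dominated_delayed iter_def dominated_0)

lemma delayed_cong:
  assumes "\<And>x. 0 \<le> x \<Longrightarrow> x \<le> t - \<delta> \<Longrightarrow> h x = h' x"
  shows "delayed \<delta> a h t = delayed \<delta> a h' t"
proof -
  have "P h s = P h' s" if "s \<in> {0..max 0 (t - \<delta>)}" for s
  \<comment> \<open>For t < \<delta> the hypothesis is void, but then s = 0 is the only point and
    the flux there is 0 for every source.\<close>
  proof (cases "s = 0")
    case False
    with that have "flux n h s = flux n h' s"
      by (intro flux_cong assms) auto
    then show ?thesis by (simp add: P_def)
  qed (simp add: P_def)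
  moreover from this have "(LINT s:{0..max 0 (t - \<delta>)}|lebesgue. P h s) = (LINT s:{0..max 0 (t - \<delta>)}|lebesgue. P h' s)"
    by (intro set_lebesgue_integral_cong) auto
  ultimately show ?thesis
    by (simp add: delayed_def)
qed

text \<open>Agreement of two sources on [0, k \<delta>) gives agreement of their images on [0, (k +
  1) \<delta>), by the delay. The base case concerns an empty range of t.\<close>

lemma iter_stable:
  assumes "0 < \<delta>" "0 \<le> t" "t < real k * \<delta>"
  shows "iter \<delta> a (Suc k) t = iter \<delta> a k t"
  using assms(2,3)
proof (induction k arbitrary: t)
  case (Suc k)
  then show ?case
    unfolding iter_Suc[of _ _ "Suc k"] iter_Suc[of _ _ k]
    by (intro delayed_cong) (auto simp: iter_Suc[symmetric] algebra_simps)
qed simp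

text \<open>Continuous dependence on the shooting height: the number of steps is fixed, and each one
  preserves limits by dominated convergence and continuity of \<open>K\<close>.\<close>

lemma iter_tendsto:
  assumes "a \<longlonglongrightarrow> a'" "0 \<le> t"
  shows "(\<lambda>i. iter \<delta> (a i) k t) \<longlonglongrightarrow> iter \<delta> a' k t"
  using assms(2)
proof (induction k arbitrary: t)
  case (Suc k)
  show ?case
    unfolding iter_Suc delayed_def
    by (intro K_tendsto tendsto_diff assms(1) P_integral_tendsto P_tendsto dominated_iter Suc P_nonneg) auto
qed simp

text \<open>Shooting: \<open>J\<close> is continuous with values between 0 and
  \<open>\<xi>\<^sub>1\<close>, so a - J(a) changes sign on that interval. A zero means that the
  function starting at height a decreases exactly to 0 at infinity.\<close>

lemma iter_height_exists:
  obtains a where "Lop n p (iter \<delta> a k) 0 = a"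
proof -
  define J where "J a = Lop n p (iter \<delta> a k) 0" for a
  have "isCont J a" for a
    unfolding continuous_at_sequentially J_def Lop_P o_def
    by (intro allI impI P_integral_tendsto dominated_iter iter_tendsto) auto
  then have "continuous_on {0..\<xi>\<^sub>1} (\<lambda>a. a - J a)"
    by (intro continuous_intros continuous_at_imp_continuous_on) auto
  moreover have "0 - J 0 \<le> 0" "0 \<le> \<xi>\<^sub>1 - J \<xi>\<^sub>1"
    unfolding J_def using Lop_nonneg Lop_le[OF dominated_iter order_refl] by auto
  ultimately obtain a where "a - J a = 0"
    using IVT'[of "\<lambda>a. a - J a" 0 0 \<xi>\<^sub>1] \<xi>\<^sub>1_pos by auto
  then show thesis
    using that[of a] by (simp add: J_def)
qed

lemma approximate_solution:
  fixes m :: nat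
  obtains h where "dominated h"
    and "\<And>t. 0 \<le> t \<Longrightarrow> t < real m \<Longrightarrow>
      h t = K t (Lop n p h (max 0 (t - 1 / Suc m))) (P h (max 0 (t - 1 / Suc m)))"
proof -
  define \<delta> where "\<delta> = 1 / real (Suc m)"
  \<comment> \<open>With delay 1/(m + 1), this many iterations settle the values on [0, m + 1),
    which covers the required t < m.\<close>
  define k where "k = Suc m * Suc m"
  have \<delta>: "0 < \<delta>" "real k * \<delta> = Suc m"
    unfolding \<delta>_def k_def of_nat_mult by simp_all
  obtain a where a: "Lop n p (iter \<delta> a k) 0 = a"
    by (rule iter_height_exists)
  show thesis
  proof (rule that[OF dominated_iter[of \<delta> a k]])
    fix t :: real assume "0 \<le> t" "t < real m"
    then have "iter \<delta> a k t = delayed \<delta> a (iter \<delta> a k) t"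
      using iter_stable[OF \<delta>(1), of t k a] \<delta>(2) by (simp add: iter_Suc)
    \<comment> \<open>The shooting condition cancels the height against \<open>Lop\<close> at
      0.\<close>
    then show "iter \<delta> a k t = K t (Lop n p (iter \<delta> a k) (max 0 (t - 1 / Suc m))) (P (iter \<delta> a k) (max 0 (t - 1 / Suc m)))"
      using a by (simp add: delayed_Lop[OF dominated_iter] \<delta>_def)
  qed
qed

section \<open>Compactness and removal of the delay\<close>

lemma flux_convergent_subsequence:
  assumes h: "\<And>m::nat. dominated (h m)"
  obtains r f where "strict_mono (r :: nat \<Rightarrow> nat)" "continuous_on {0..} f"
    "\<And>s. 0 \<le> s \<Longrightarrow> (\<lambda>i. flux n (h (r i)) s) \<longlonglongrightarrow> f s"
proof -
  obtain L where L0: "0 \<le> L"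
    and L: "\<And>h s r. dominated h \<Longrightarrow> 0 \<le> s \<Longrightarrow> s \<le> r \<Longrightarrow> \<bar>flux n h r - flux n h s\<bar> \<le> L * (r - s)"
    using flux_dominated_Lipschitz by auto
  have L': "dist (flux n (h m) r) (flux n (h m) s) \<le> L * dist r s" if "0 \<le> s" "0 \<le> r" for m r s
    using L[OF h, of s r m] L[OF h, of r s m] that
    by (cases "s \<le> r") (auto simp: dist_real_def abs_minus_commute)
  have bound: "norm (flux n (h m) s) \<le> \<xi>\<^sub>2 powr (p - 1)" if "0 \<le> s" for m s
  proof -
    have "flux n (h m) s = P (h m) s powr (p - 1)"
      using p_gt_1 dominatedD(4)[OF h] by (simp add: P_def powr_powr)
    also have "\<dots> \<le> \<xi>\<^sub>2 powr (p - 1)"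
      using that p_gt_1 dominatedD(6)[OF h] by (intro powr_mono2) auto
    finally show ?thesis
      using dominatedD(4)[OF h] by simp
  qed
  \<comment> \<open>Arzela-Ascoli by hand: a diagonal argument gives convergence on the countable
    set of nonnegative rationals, and the common Lipschitz constant carries it to every s >=
    0.\<close>
  define S where "S = {0..} \<inter> (\<rat> :: real set)"
  have "countable S"
    unfolding S_def using countable_rat by (rule countable_Int2)
  then obtain r where r: "strict_mono (r :: nat \<Rightarrow> nat)"
    "\<And>x. x \<in> S \<Longrightarrow> \<exists>y. (\<lambda>i. flux n (h (r i)) x) \<longlonglongrightarrow> y"
    by (rule function_convergent_subsequence[of S "\<lambda>m. flux n (h m)" "\<xi>\<^sub>2 powr (p - 1)"])
      (use bound in \<open>auto simp: S_def\<close>)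
  have "\<exists>y. (\<lambda>i. flux n (h (r i)) s) \<longlonglongrightarrow> y" if s: "0 \<le> s" for s
  proof -
    have "Cauchy (\<lambda>i. flux n (h (r i)) s)"
    proof (rule metric_CauchyI)
      fix e :: real assume e: "0 < e"
      \<comment> \<open>Two Lipschitz errors and one Cauchy error make up e; L + 1 keeps the
        denominator positive when L = 0.\<close>
      define d where "d = e / (3 * (L + 1))"
      have d: "0 < d" "L * d < e / 3"
        using e L0 by (auto simp: d_def field_simps)
      obtain x where x: "x \<in> \<rat>" "s < x" "x < s + d"
        using Rats_dense_in_real[of s "s + d"] d by auto
      then have xS: "x \<in> S"
        using s by (simp add: S_def)
      have close: "dist (flux n (h (r i)) s) (flux n (h (r i)) x) < e / 3" for i
      proof -
        have "dist (flux n (h (r i)) s) (flux n (h (r i)) x) \<le> L * dist s x"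
          using s x by (intro L') auto
        also have "\<dots> \<le> L * d"
          using x L0 by (intro mult_left_mono) (auto simp: dist_real_def)
        finally show ?thesis
          using d by simp
      qed
      have "Cauchy (\<lambda>i. flux n (h (r i)) x)"
        using r(2)[OF xS] LIMSEQ_imp_Cauchy by blast
      then obtain M where M: "\<And>i j. i \<ge> M \<Longrightarrow> j \<ge> M \<Longrightarrow>
          dist (flux n (h (r i)) x) (flux n (h (r j)) x) < e / 3"
        using e by (meson metric_CauchyD divide_pos_pos zero_less_numeral)
      show "\<exists>M. \<forall>i\<ge>M. \<forall>j\<ge>M. dist (flux n (h (r i)) s) (flux n (h (r j)) s) < e"
      proof (intro exI allI impI)
        fix i j assume ij: "M \<le> i" "M \<le> j"
        show "dist (flux n (h (r i)) s) (flux n (h (r j)) s) < e"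
          using close[of i] close[of j] M[OF ij] unfolding dist_real_def by linarith
      qed
    qed
    then show ?thesis
      by (simp add: Cauchy_convergent_iff convergent_def)
  qed
  then obtain f where f: "\<And>s. 0 \<le> s \<Longrightarrow> (\<lambda>i. flux n (h (r i)) s) \<longlonglongrightarrow> f s"
    by metis
  have "L-lipschitz_on {0..} f"
  proof (rule lipschitz_onI[OF _ L0])
    fix x y :: real assume xy: "x \<in> {0..}" "y \<in> {0..}"
    then have "(\<lambda>i. dist (flux n (h (r i)) x) (flux n (h (r i)) y)) \<longlonglongrightarrow> dist (f x) (f y)"
      by (intro tendsto_dist f) auto
    then show "dist (f x) (f y) \<le> L * dist x y"
      by (rule LIMSEQ_le_const2) (use L' xy in auto)
  qed
  then have "continuous_on {0..} f"
    by (rule lipschitz_on_continuous_on)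
  with r(1) f show thesis
    by (intro that)
qed

text \<open>Compactness is applied to the fluxes. Their limit determines those of \<open>P\<close>
  and \<open>Lop\<close>, and continuity of \<open>K\<close> then makes the sources themselves
  converge pointwise.\<close>

lemma truncated_solution:
  obtains h where "dominated h" "\<And>t. 0 \<le> t \<Longrightarrow> h t = K t (Lop n p h t) (P h t)"
proof -
  have "\<exists>h. dominated h \<and> (\<forall>t. 0 \<le> t \<longrightarrow> t < real m \<longrightarrow>
      h t = K t (Lop n p h (max 0 (t - 1 / Suc m))) (P h (max 0 (t - 1 / Suc m))))" for m
    by (rule approximate_solution[of m]) blast
  then obtain h' where h': "\<And>m. dominated (h' m)"
    "\<And>m t. 0 \<le> t \<Longrightarrow> t < real m \<Longrightarrow>
      h' m t = K t (Lop n p (h' m) (max 0 (t - 1 / Suc m))) (P (h' m) (max 0 (t - 1 / Suc m)))"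
    by metis
  obtain r f where r: "strict_mono (r :: nat \<Rightarrow> nat)" and f: "continuous_on {0..} f"
    "\<And>s. 0 \<le> s \<Longrightarrow> (\<lambda>i. flux n (h' (r i)) s) \<longlonglongrightarrow> f s"
    using flux_convergent_subsequence[of h'] h'(1) by blast
  obtain L where L0: "0 \<le> L"
    and L: "\<And>h s r. dominated h \<Longrightarrow> 0 \<le> s \<Longrightarrow> s \<le> r \<Longrightarrow> \<bar>flux n h r - flux n h s\<bar> \<le> L * (r - s)"
    using flux_dominated_Lipschitz by auto
  define h where "h i = h' (r i)" for i
  define \<tau> where "\<tau> i t = max 0 (t - 1 / real (Suc (r i)))" for i t
  \<comment> \<open>\<open>w\<close> and \<open>u\<close> are the limits of \<open>P (h i)\<close>
    and \<open>Lop n p (h i)\<close>; that both belong to the single source \<open>k\<close> is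
    established only at the end.\<close>
  define w where "w s = f s powr q" for s
  define u where "u t = (LINT s:{t..}|lebesgue. w s)" for t
  define k where "k t = K t (u t) (w t)" for t
  have h: "dominated (h i)" for i
    by (simp add: h_def h'(1))
  have flux_lim: "(\<lambda>i. flux n (h i) s) \<longlonglongrightarrow> f s" if "0 \<le> s" for s
    using f(2)[OF that] by (simp add: h_def)
  have f0: "0 \<le> f s" if "0 \<le> s" for s
    using dominatedD(4)[OF h] by (intro LIMSEQ_le_const[OF flux_lim[OF that]]) auto
  have w_lim: "(\<lambda>i. P (h i) s) \<longlonglongrightarrow> w s" if "0 \<le> s" for s
    unfolding P_def w_def using q_pos dominatedD(4)[OF h]
    by (intro tendsto_powr' flux_lim that tendsto_const) auto
  have w_cont: "continuous_on {0..} w"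
    unfolding w_def using f0 p_gt_1 by (intro continuous_on_powr' f continuous_on_const) auto
  have w_le: "w s \<le> P B s" if "0 \<le> s" for s
    using dominatedD(5)[OF h] by (intro LIMSEQ_le_const2[OF w_lim[OF that]]) auto
  have w_int: "set_integrable lebesgue {0..} w"
    using w_le by (intro set_integrable_dominated[OF _ w_cont P_B_integrable]) (auto simp: w_def)
  have u_lim: "(\<lambda>i. Lop n p (h i) t) \<longlonglongrightarrow> u t" if "0 \<le> t" for t
    unfolding Lop_P u_def
  proof (rule set_integral_dominated_convergence)
    show "continuous_on {t..} (P (h i))" for i
      using P_continuous[OF h] that by (rule_tac continuous_on_subset) auto
    show "continuous_on {t..} w"
      using w_cont that by (rule_tac continuous_on_subset) auto
    show "set_integrable lebesgue {t..} (P B)"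
      using P_B_integrable that by (rule_tac set_integrable_subset) auto
    show "\<bar>P (h i) x\<bar> \<le> P B x" for i x
      using dominatedD(5)[OF h] by simp
    show "(\<lambda>i. P (h i) x) \<longlonglongrightarrow> w x" if "x \<in> {t..}" for x
      using that \<open>0 \<le> t\<close> by (intro w_lim) auto
  qed auto
  have k: "dominated k"
    unfolding dominated_def
  proof (intro conjI allI impI)
    have "continuous_on {0..} u"
      unfolding u_def by (rule tail_integral_continuous[OF w_cont w_int])
    then show "continuous_on {0..} k"
      unfolding k_def by (intro K_compose_continuous w_cont) (auto simp: w_def)
  qed (auto simp: k_def w_def K_bounds)
  have h_lim: "(\<lambda>i. h i t) \<longlonglongrightarrow> k t" if t: "0 \<le> t" for t
  proof -
    have \<tau>: "0 \<le> \<tau> i t" "\<tau> i t \<le> t" "t - \<tau> i t \<le> 1 / real (Suc (r i))" for i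
      using t by (auto simp: \<tau>_def)
    have \<delta>: "(\<lambda>i. c * (1 / real (Suc (r i)))) \<longlonglongrightarrow> 0" for c
      using tendsto_mult[OF tendsto_const LIMSEQ_subseq_LIMSEQ[OF LIMSEQ_inverse_real_of_nat r], of c]
      by (simp add: o_def divide_inverse)
    \<comment> \<open>The Lipschitz constants do not depend on i, so shifting the evaluation point
      by at most 1/(r i + 1) disappears in the limit.\<close>
    have "(\<lambda>i. flux n (h i) t - flux n (h i) (\<tau> i t)) \<longlonglongrightarrow> 0"
    proof (rule Lim_null_comparison[OF always_eventually \<delta>[of L]], intro allI)
      fix i
      have "L * (t - \<tau> i t) \<le> L * (1 / real (Suc (r i)))"
        using \<tau>(3) L0 by (intro mult_left_mono) auto
      then show "norm (flux n (h i) t - flux n (h i) (\<tau> i t)) \<le> L * (1 / real (Suc (r i)))"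
        using L[OF h \<tau>(1,2)] by (simp only: real_norm_def) (meson order_trans)
    qed
    from tendsto_diff[OF flux_lim[OF t] this] have "(\<lambda>i. flux n (h i) (\<tau> i t)) \<longlonglongrightarrow> f t"
      by simp
    then have 1: "(\<lambda>i. P (h i) (\<tau> i t)) \<longlonglongrightarrow> w t"
      unfolding P_def w_def using q_pos dominatedD(4)[OF h] by (intro tendsto_powr' tendsto_const) auto
    have "(\<lambda>i. Lop n p (h i) (\<tau> i t) - Lop n p (h i) t) \<longlonglongrightarrow> 0"
    proof (rule Lim_null_comparison[OF always_eventually \<delta>[of \<xi>\<^sub>2]], intro allI)
      fix i
      have "\<xi>\<^sub>2 * (t - \<tau> i t) \<le> \<xi>\<^sub>2 * (1 / real (Suc (r i)))"
        using \<tau>(3) \<xi>\<^sub>2_pos by (intro mult_left_mono) auto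
      then show "norm (Lop n p (h i) (\<tau> i t) - Lop n p (h i) t) \<le> \<xi>\<^sub>2 * (1 / real (Suc (r i)))"
        using Lop_Lipschitz[OF h \<tau>(1,2)] by (simp only: real_norm_def) (meson order_trans)
    qed
    from tendsto_add[OF this u_lim[OF t]] have 2: "(\<lambda>i. Lop n p (h i) (\<tau> i t)) \<longlonglongrightarrow> u t"
      by simp
    have 3: "(\<lambda>i. K t (Lop n p (h i) (\<tau> i t)) (P (h i) (\<tau> i t))) \<longlonglongrightarrow> k t"
      unfolding k_def by (intro K_tendsto t 1 2 P_nonneg)
    obtain N :: nat where N: "t < real N"
      using reals_Archimedean2 by blast
    \<comment> \<open>Since r i >= i, the delayed equation, valid below r i, eventually holds at
      t.\<close>
    have "K t (Lop n p (h i) (\<tau> i t)) (P (h i) (\<tau> i t)) = h i t" if "N \<le> i" for i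
    proof -
      have "N \<le> r i"
        using that seq_suble[OF r, of i] by linarith
      then have "t < real (r i)"
        using N by linarith
      from h'(2)[OF t this] show ?thesis
        by (simp add: h_def \<tau>_def)
    qed
    then show ?thesis
      using 3 by (elim Lim_transform_eventually) (auto simp: eventually_sequentially)
  qed
  \<comment> \<open>Now that the sources converge to \<open>k\<close>, uniqueness of limits
    identifies \<open>P k\<close> with \<open>w\<close>.\<close>
  have P_eq: "P k s = w s" if "0 \<le> s" for s
    using LIMSEQ_unique[OF P_tendsto[OF h k h_lim] w_lim[OF that]] by simp
  have Lop_eq: "Lop n p k t = u t" if "0 \<le> t" for t
    unfolding Lop_P u_def using that P_eq by (intro set_lebesgue_integral_cong) auto
  show thesis
    by (rule that[OF k]) (simp add: P_eq Lop_eq, simp add: k_def)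
qed

section \<open>Membership in \<open>Q\<close>\<close>

text \<open>The decay exponent of the radial fundamental solution of the p-Laplacian.\<close>

abbreviation "\<gamma> \<equiv> (real n - p) / (p - 1)"

lemma \<gamma>_gt: "p < \<gamma>"
  using p_square_less p_gt_1 by (simp add: field_simps power2_eq_square)

lemma \<gamma>_pos: "0 < \<gamma>"
  using \<gamma>_gt p_gt_1 by linarith

lemma exponent_eq: "(1 - real n) * q + 1 = - \<gamma>"
  using p_gt_1 by (simp add: field_simps)

text \<open>With the inner moment frozen at c, the outer integral is explicit. Taking c as the
  moment over [0, l] gives the lower barrier; taking c as a bound for all moments gives the
  decay.\<close>

lemma flux_tail:
  assumes "0 < r" "0 \<le> c"
  shows "set_integrable lebesgue {r..} (\<lambda>s. (s powr (1 - real n) * c) powr q)"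
    and "(LINT s:{r..}|lebesgue. (s powr (1 - real n) * c) powr q) = c powr q * (r powr (- \<gamma>) / \<gamma>)"
proof -
  have e: "(1 - real n) * q < -1"
    using exponent_eq \<gamma>_pos by linarith
  have "(\<lambda>s. (s powr (1 - real n) * c) powr q) = (\<lambda>s. c powr q * s powr ((1 - real n) * q))"
    using assms(2) by (simp add: powr_mult powr_powr mult.commute)
  then show "set_integrable lebesgue {r..} (\<lambda>s. (s powr (1 - real n) * c) powr q)"
    and "(LINT s:{r..}|lebesgue. (s powr (1 - real n) * c) powr q) = c powr q * (r powr (- \<gamma>) / \<gamma>)"
    using powr_tail_integral[OF e assms(1), of "c powr q"] by (simp_all only: exponent_eq) simp_all
qed

text \<open>For r >= l the inner moments are at least the one over [0, l], so the tail integral is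
  at least a multiple of r^(-\<gamma>); condition (3) says that this multiple is large
  enough.\<close>

lemma Lop_lower:
  assumes h: "dominated h"
    and lower: "\<And>t. 0 \<le> t \<Longrightarrow> \<xi>\<^sub>1 powr (- \<beta>) * \<phi> (t, inverse \<xi>\<^sub>1 * prof t) \<le> h t"
    and r: "0 \<le> r"
  shows "inverse \<xi>\<^sub>1 * prof r \<le> Lop n p h r"
proof -
  define I where "I = (LINT t:{0..l}|lebesgue. t ^ (n - 1) * h t)"
  define J where "J = (LINT t:{0..l}|lebesgue. t ^ (n - 1) * \<phi> (t, inverse \<xi>\<^sub>1 * prof t))"
  have I0: "0 \<le> I"
    unfolding I_def using dominatedD(2)[OF h] by (intro set_integral_nonneg) auto
  have \<phi>c: "continuous_on {0..} (\<lambda>t. \<phi> (t, inverse \<xi>\<^sub>1 * prof t))"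
  proof (rule continuous_on_compose2[OF \<phi>_cont])
    show "continuous_on {0..} (\<lambda>t. (t, inverse \<xi>\<^sub>1 * prof t))"
      by (intro continuous_on_Pair continuous_on_id continuous_on_mult continuous_on_const prof_continuous)
    show "(\<lambda>t. (t, inverse \<xi>\<^sub>1 * prof t)) ` {0..} \<subseteq> {0..} \<times> {0..}"
      using \<xi>\<^sub>1_pos by (auto simp: less_imp_le)
  qed
  have "\<xi>\<^sub>1 powr (- \<beta>) * J = (LINT t:{0..l}|lebesgue. t ^ (n - 1) * (\<xi>\<^sub>1 powr (- \<beta>) * \<phi> (t, inverse \<xi>\<^sub>1 * prof t)))"
    unfolding J_def by (simp add: mult.left_commute)
  also have "\<dots> \<le> I"
    unfolding I_def using lower
    by (intro set_integral_mono moment_integrable dominatedD(1)[OF h] continuous_on_mult continuous_on_const \<phi>c)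
      (auto intro!: mult_left_mono)
  finally have JI: "\<xi>\<^sub>1 powr (- \<beta>) * J \<le> I" .
  \<comment> \<open>Chosen so that condition (3) bounds c^(p-1) times a moment from below by 1,
    ready for the power 1/(p - 1).\<close>
  define c where "c = \<xi>\<^sub>1 * (1 / \<gamma>)"
  have c: "0 < c"
    unfolding c_def using \<xi>\<^sub>1_pos p_less_n p_gt_1 by simp
  have "1 \<le> \<xi>\<^sub>1 powr (p - 1 - \<beta>) * (1 / \<gamma>) powr (p - 1) * J"
    using \<phi>_moment by (simp add: J_def)
  also have "\<dots> = c powr (p - 1) * (\<xi>\<^sub>1 powr (- \<beta>) * J)"
    unfolding c_def powr_mult by (simp add: powr_diff powr_minus divide_inverse mult_ac)
  also have "\<dots> \<le> c powr (p - 1) * I"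
    by (intro mult_left_mono JI) auto
  finally have "1 \<le> (c powr (p - 1) * I) powr q"
    using q_pos by (intro ge_one_powr_ge_zero) auto
  also have "\<dots> = c * I powr q"
    using I0 c p_gt_1 by (subst powr_mult) (simp_all add: powr_powr)
  finally have Iq: "inverse \<xi>\<^sub>1 \<le> I powr q / \<gamma>"
    using \<xi>\<^sub>1_pos p_less_n by (simp add: c_def divide_simps mult_ac)
  have *: "inverse \<xi>\<^sub>1 * prof r \<le> Lop n p h r" if rl: "l \<le> r" for r
  proof -
    have r0: "0 < r" using rl l_pos by simp
    have "inverse \<xi>\<^sub>1 * prof r \<le> (I powr q / \<gamma>) * prof r"
      using Iq by (intro mult_right_mono) (auto simp: less_imp_le)
    also have "\<dots> = (LINT s:{r..}|lebesgue. (s powr (1 - real n) * I) powr q)"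
      unfolding flux_tail(2)[OF r0 I0] using rl by (simp add: profile_def max_def)
    also have "\<dots> \<le> Lop n p h r"
      unfolding Lop_P P_def
    proof (rule set_integral_mono)
      show "set_integrable lebesgue {r..} (\<lambda>s. flux n h s powr q)"
        using P_integrable[OF h, of "{r..}"] r0 by (auto simp: P_def[abs_def])
      show "(s powr (1 - real n) * I) powr q \<le> flux n h s powr q" if "s \<in> {r..}" for s
        unfolding flux_def I_def using that rl l_pos q_pos I0[unfolded I_def]
        by (intro powr_mono2 mult_left_mono moment_mono dominatedD(1)[OF h] dominatedD(2)[OF h]) auto
    qed (rule flux_tail(1)[OF r0 I0])
    finally show ?thesis .
  qed
  show ?thesis
  proof (cases "l \<le> r")
    \<comment> \<open>Below l the profile is constant while \<open>Lop\<close> is antimonotone, so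
      the bound at l suffices.\<close>
    case False
    then have "inverse \<xi>\<^sub>1 * prof r = inverse \<xi>\<^sub>1 * prof l"
      by (simp add: profile_def max_def)
    also have "\<dots> \<le> Lop n p h l"
      by (rule *) simp
    also have "\<dots> \<le> Lop n p h r"
      using False r by (intro Lop_antimono[OF h]) auto
    finally show ?thesis .
  qed (rule *)
qed

text \<open>Condition (7) bounds all inner moments by the total moment of \<open>B\<close>.\<close>

lemma Lop_decay:
  assumes h: "dominated h"
  shows "\<exists>D\<ge>0. \<forall>r>0. Lop n p h r \<le> D * r powr (- \<gamma>)"
proof -
  define M where "M = (LINT t:{0..}|lebesgue. t ^ (n - 1) * B t)"
  have B: "set_integrable lebesgue {0..} (\<lambda>t. t ^ (n - 1) * B t)"
    unfolding B_def using H_moment by (simp add: mult.left_commute)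
  have M0: "0 \<le> M"
    unfolding M_def using B_nonneg by (intro set_integral_nonneg) auto
  have M: "(LINT t:{0..s}|lebesgue. t ^ (n - 1) * h t) \<le> M" for s
    unfolding M_def set_lebesgue_integral_def
  proof (rule Bochner_Integration.integral_mono)
    show "integrable lebesgue (\<lambda>x. indicat_real {0..s} x *\<^sub>R (x ^ (n - 1) * h x))"
      using moment_integrable[OF dominatedD(1)[OF h] order_refl] by (simp add: set_integrable_def)
    show "integrable lebesgue (\<lambda>x. indicat_real {0..} x *\<^sub>R (x ^ (n - 1) * B x))"
      using B by (simp add: set_integrable_def)
    show "indicat_real {0..s} x *\<^sub>R (x ^ (n - 1) * h x) \<le> indicat_real {0..} x *\<^sub>R (x ^ (n - 1) * B x)" for x
      using dominatedD(3)[OF h, of x] B_nonneg[of x] by (auto simp: indicator_def intro: mult_left_mono)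
  qed
  have "Lop n p h r \<le> M powr q / \<gamma> * r powr (- \<gamma>)" if r: "0 < r" for r
  proof -
    have "Lop n p h r \<le> (LINT s:{r..}|lebesgue. (s powr (1 - real n) * M) powr q)"
      unfolding Lop_P P_def
    proof (rule set_integral_mono)
      show "set_integrable lebesgue {r..} (\<lambda>s. flux n h s powr q)"
        using P_integrable[OF h, of "{r..}"] r by (auto simp: P_def[abs_def])
      show "flux n h s powr q \<le> (s powr (1 - real n) * M) powr q" for s
        using q_pos M[of s] dominatedD(4)[OF h, of s] unfolding flux_def
        by (intro powr_mono2 mult_left_mono) auto
    qed (rule flux_tail(1)[OF r M0])
    then show ?thesis
      unfolding flux_tail(2)[OF r M0] by (simp add: mult_ac)
  qed
  moreover have "0 \<le> M powr q / \<gamma>"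
    using \<gamma>_pos by (intro divide_nonneg_pos) auto
  ultimately show ?thesis
    by blast
qed

lemma Lop_in_Lambda:
  assumes h: "dominated h"
  shows "Lop n p h \<in> Lambda n p"
proof -
  obtain D where D: "0 \<le> D" "\<And>r. 0 < r \<Longrightarrow> Lop n p h r \<le> D * r powr (- \<gamma>)"
    using Lop_decay[OF h] by auto
  \<comment> \<open>\<gamma> can exceed n, whereas the criterion requires an exponent strictly
    between p and n; lowering it only weakens the decay for t >= 1.\<close>
  obtain \<gamma>' where \<gamma>': "p < \<gamma>'" "\<gamma>' < min \<gamma> (real n)"
    using dense[of p "min \<gamma> (real n)"] \<gamma>_gt p_less_n by auto
  show ?thesis
  proof (rule Lambda_of_decay[OF n_ge_2 p_gt_1 \<gamma>'(1)])
    show "\<gamma>' < real n"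
      using \<gamma>' by simp
    show "continuous_on {0..} (Lop n p h)"
      by (rule Lop_continuous[OF h])
    show "0 \<le> Lop n p h t \<and> Lop n p h t \<le> \<xi>\<^sub>1" if "0 \<le> t" for t
      using Lop_nonneg Lop_le[OF h that] by blast
    show "0 \<le> max D \<xi>\<^sub>1"
      using D by simp
    fix t :: real assume t: "0 < t"
    show "Lop n p h t \<le> max D \<xi>\<^sub>1 * t powr (- \<gamma>')"
    proof (cases "1 \<le> t")
      case True
      have "Lop n p h t \<le> D * t powr (- \<gamma>)"
        using D(2) t .
      also have "\<dots> \<le> max D \<xi>\<^sub>1 * t powr (- \<gamma>')"
        using True \<gamma>' D(1) by (intro mult_mono powr_mono) auto
      finally show ?thesis .
    next
      case False
      \<comment> \<open>Near 0 the bound \<open>\<xi>\<^sub>1\<close> suffices, which explains the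
        maximum in the constant.\<close>
      have "1 \<le> t powr (- \<gamma>')"
        using powr_mono2'[of "- \<gamma>'" t 1] False t \<gamma>' p_gt_1 by auto
      then have "\<xi>\<^sub>1 * 1 \<le> max D \<xi>\<^sub>1 * t powr (- \<gamma>')"
        using \<xi>\<^sub>1_pos by (intro mult_mono) auto
      then show ?thesis
        using Lop_le[OF h, of t] t by simp
    qed
  qed
qed

section \<open>Regularity of \<open>Lop n p h\<close> and the fixed point\<close>

lemma Lop_derivative:
  assumes h: "dominated h" and r: "0 \<le> r"
  shows "(Lop n p h has_real_derivative - P h r) (at r within {0..})"
  unfolding Lop_P[abs_def]
  by (intro tail_integral_has_derivative P_continuous[OF h] P_integrable[OF h] r) auto

lemma dhalf_Lop:
  assumes h: "dominated h" and r: "0 \<le> r"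
  shows "dhalf (Lop n p h) r = - P h r"
  unfolding dhalf_def
proof (rule vector_derivative_within)
  \<comment> \<open>Uniqueness of the derivative needs a nontrivial filter; points to the right of r
    provide one even at r = 0.\<close>
  show "at r within {0..} \<noteq> bot"
  proof
    assume "at r within {0..} = bot"
    moreover have "{r<..} \<subseteq> {0..}"
      using r by auto
    ultimately have "at_right r \<le> bot"
      by (metis at_le)
    then show False
      using trivial_limit_at_right_real[of r] by (simp add: bot_unique)
  qed
  show "(Lop n p h has_vector_derivative - P h r) (at r within {0..})"
    using Lop_derivative[OF assms] by (simp add: has_real_derivative_iff_has_vector_derivative)
qed

lemma Lop_C1:
  assumes h: "dominated h"
  shows "C1_halfline (Lop n p h)"
  unfolding C1_halfline_def
proof
  show "Lop n p h differentiable_on {0..}"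
    using Lop_derivative[OF h] by (auto simp: differentiable_on_def real_differentiable_def)
  have "continuous_on {0..} (\<lambda>r. - P h r)"
    by (intro continuous_on_minus P_continuous h)
  then show "continuous_on {0..} (dhalf (Lop n p h))"
    using dhalf_Lop[OF h] by (subst continuous_on_cong[OF refl]) auto
qed

text \<open>Allows arbitrary values on the negative reals, as \<open>Kop\<close> may have there;
  fluxes only see [0, s].\<close>

lemma Lambda_dominated:
  assumes h: "dominated h" and eq: "\<And>t. 0 \<le> t \<Longrightarrow> h' t = h t"
  shows "h' \<in> Lambda n p"
proof -
  have c: "continuous_on {0..} h'"
    using dominatedD(1)[OF h] eq by (subst continuous_on_cong[OF refl]) auto
  have "flux n h' s = flux n h s" for s
    by (rule flux_cong) (rule eq)
  then have "(\<lambda>s. flux n h' s powr q) = P h"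
    by (simp add: P_def[abs_def])
  moreover have "set_integrable lebesgue {0..} (P h)"
    by (rule P_integrable[OF h]) auto
  moreover have "h' \<in> borel_measurable (lebesgue_on {0..})"
    using c by (intro continuous_imp_measurable_on_sets_lebesgue) auto
  ultimately show ?thesis
    using moment_integrable[OF c order_refl] dominatedD(2)[OF h] eq by (simp add: Lambda_def)
qed

text \<open>The a priori bounds make the truncation inactive at \<open>g\<close>, so the truncated
  source \<open>h\<close> equals \<open>Kop F \<beta> g\<close> on the half-line, and
  \<open>g = Lop n p h\<close> becomes the fixed point equation.\<close>

lemma fixed_point_exists:
  "\<exists>g\<in>Qset n p l \<xi>\<^sub>1 \<xi>\<^sub>2. Kop F \<beta> g \<in> Lambda n p \<and> (\<forall>r\<ge>0. Top n p F \<beta> g r = g r)"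
proof -
  obtain h where h: "dominated h" and h_eq: "\<And>t. 0 \<le> t \<Longrightarrow> h t = K t (Lop n p h t) (P h t)"
    by (rule truncated_solution) blast
  define g where "g = Lop n p h"
  have g: "inverse \<xi>\<^sub>1 * prof r \<le> g r" "g r \<le> \<xi>\<^sub>1" "\<bar>dhalf g r\<bar> = P h r" "P h r \<le> \<xi>\<^sub>2" if "0 \<le> r" for r
  proof -
    \<comment> \<open>On the half-line \<open>h\<close> is a value of \<open>K\<close>, so the lower
      bound for \<open>K\<close> supplies the hypothesis on the source.\<close>
    show "inverse \<xi>\<^sub>1 * prof r \<le> g r"
      unfolding g_def using h _ that
      by (rule Lop_lower) (subst h_eq, simp, rule K_bounds(3), auto)
    show "g r \<le> \<xi>\<^sub>1"
      unfolding g_def by (rule Lop_le[OF h that])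
    show "\<bar>dhalf g r\<bar> = P h r"
      unfolding g_def using dhalf_Lop[OF h that] by simp
    show "P h r \<le> \<xi>\<^sub>2"
      using h that by (rule dominatedD(6))
  qed
  have Kop: "Kop F \<beta> g t = h t" if "0 \<le> t" for t
  proof -
    have "clip t (g t) = g t"
      using g(1,2)[OF that] by (simp add: clip_def)
    then have "K t (g t) (P h t) = F (t, g t, P h t) * g t powr (- \<beta>)"
      using g(4)[OF that] by (simp add: K_def)
    then show ?thesis
      using h_eq[OF that] g(3)[OF that] by (simp add: Kop_def g_def)
  qed
  have "g \<in> Qset n p l \<xi>\<^sub>1 \<xi>\<^sub>2"
    using g Lop_in_Lambda[OF h] Lop_C1[OF h] by (simp add: Qset_def g_def)
  moreover have "Kop F \<beta> g \<in> Lambda n p"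
    using h Kop by (rule Lambda_dominated)
  moreover have "Top n p F \<beta> g r = g r" for r
  proof -
    have "flux n (Kop F \<beta> g) s = flux n h s" for s
      by (rule flux_cong) (rule Kop)
    then show ?thesis
      by (simp add: Top_def Lop_def g_def)
  qed
  ultimately show ?thesis
    by blast
qed

end

theorem proposition3p3:
  fixes n :: nat and p \<alpha> l \<xi>\<^sub>1 \<xi>\<^sub>2 \<beta> :: real
    and F :: "real \<times> real \<times> real \<Rightarrow> real" and \<phi> :: "real \<times> real \<Rightarrow> real"
  assumes "n \<ge> 2"
    and "1 < p" and "p < min 2 (sqrt (real n))"
    and "0 < \<alpha>" and "\<alpha> \<le> 1"
    and "0 < l" and "0 < \<xi>\<^sub>1" and "0 < \<xi>\<^sub>2"
    and "admissible n p \<alpha> l \<xi>\<^sub>1 \<xi>\<^sub>2 F \<phi> \<beta>"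
  shows "\<exists>g\<in>Qset n p l \<xi>\<^sub>1 \<xi>\<^sub>2.
           Kop F \<beta> g \<in> Lambda n p \<and>
           (\<forall>r\<ge>0. Top n p F \<beta> g r = g r) \<and>
           (\<forall>r\<ge>0. g r =
              (LINT s:{r..}|lebesgue.
                 (s powr (1 - real n) *
                  (LINT t:{0..s}|lebesgue.
                     t ^ (n - 1) * (F (t, g t, \<bar>dhalf g t\<bar>) * g t powr (- \<beta>))))
                 powr (1 / (p - 1))))"
proof -
  interpret admissible_data n p \<alpha> l \<xi>\<^sub>1 \<xi>\<^sub>2 \<beta> F \<phi>
    using assms by unfold_locales
  obtain g where "g \<in> Qset n p l \<xi>\<^sub>1 \<xi>\<^sub>2" "Kop F \<beta> g \<in> Lambda n p"
    and T: "\<forall>r\<ge>0. Top n p F \<beta> g r = g r"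
    using fixed_point_exists by blast
  moreover from T have "\<forall>r\<ge>0. g r = (LINT s:{r..}|lebesgue.
                 (s powr (1 - real n) *
                  (LINT t:{0..s}|lebesgue.
                     t ^ (n - 1) * (F (t, g t, \<bar>dhalf g t\<bar>) * g t powr (- \<beta>))))
                 powr (1 / (p - 1)))"
    by (simp add: Top_def Lop_def flux_def Kop_def)
  ultimately show ?thesis
    by (intro bexI[of _ g] conjI)
qed

end
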